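(* Let $X\subseteq\mathbb{R}^d$ and $\Omega\subseteq\mathbb{R}^D$ be closed, let $\varphi\in C_0(X\times\Omega)$, and let $1\le p<\infty$. Then $$\mathcal{F}(X,\Omega)\cong\bigcup_{\pi\in\mathcal{P}(\Omega)}\mathcal{L}^p(\pi),$$ where $\cong$ denotes isometric isomorphism and the union carries the union norm.
   Context: $C_0$ denotes continuous real functions vanishing at infinity. $\mathcal{M}(\Omega)$ is the Banach space of signed, finite, regular Borel (Radon) measures on $\Omega$ with total variation norm $\|\mu\|_{\mathcal{M}(\Omega)}=|\mu|(\Omega)$, and $\mathcal{P}(\Omega)$ its subset of probability measures. Integral RKBS: for $\mu\in\mathcal{M}(\Omega)$ let $(A\mu)(x)=\int_\Omega\varphi(x,w)\,d\mu(w)$, $x\in X$. Then $\mathcal{F}(X,\Omega):=\{f:X\to\mathbb{R}\mid\exists\mu\in\mathcal{M}(\Omega),\ f=A\mu\}$ with norm $\|f\|_{\mathcal{F}(X,\Omega)}:=\inf_{f=A\mu}\|\mu\|_{\mathcal{M}(\Omega)}$. $p$-norm RKBS: for $\pi\in\mathcal{P}(\Omega)$ and $1\le p<\infty$, $\mathcal{L}^p(\pi)$ is the space of functions $f:X\to\mathbb{R}$ of the form $f(x)=(Ah)(x):=\int_\Omega\varphi(x,w)h(w)\,d\pi(w)$ for some $h\in L^p(\pi)$, with norm $\|f\|_{\mathcal{L}^p(\pi)}:=\inf_{f=Ah}\|h\|_{L^p(\pi)}$. Union: for a family of normed spaces $(\mathcal{Z}_i)_{i\in I}$ (here, spaces of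 functions on $X$), $\mathcal{Z}_\cup=\bigcup_{i\in I}\mathcal{Z}_i=\{z\mid\exists i\in I,\ z\in\mathcal{Z}_i\}$ with norm $\|z\|_{\mathcal{Z}_\cup}:=\inf_{i:\,z\in\mathcal{Z}_i}\|z\|_{\mathcal{Z}_i}$. *)

theory Defs
  imports "HOL-Analysis.Analysis" "HOL-Probability.Probability_Measure"
begin

definition C0 :: "'a::topological_space set \<Rightarrow> ('a \<Rightarrow> real) set" where
  "C0 S = {f. continuous_on S f \<and>
     (\<forall>\<epsilon>>0. \<exists>K. compact K \<and> K \<subseteq> S \<and> (\<forall>z\<in>S - K. \<bar>f z\<bar> < \<epsilon>))}"


text \<open>
  A signed measure on \<open>\<Omega>\<close> is a real-valued (hence finite) countably additive set function
  on the Borel subsets of \<open>\<Omega>\<close>. Requiring the value \<open>0\<close> on all other sets makes equality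
  of set functions coincide with equality of signed measures.
\<close>

abbreviation borel_on :: "'b::topological_space set \<Rightarrow> 'b measure" where
  "borel_on \<Omega> \<equiv> restrict_space borel \<Omega>"

definition signed_measure :: "'b::topological_space set \<Rightarrow> ('b set \<Rightarrow> real) \<Rightarrow> bool" where
  "signed_measure \<Omega> \<mu> \<longleftrightarrow>
     (\<forall>E. E \<notin> sets (borel_on \<Omega>) \<longrightarrow> \<mu> E = 0) \<and>
     (\<forall>E :: nat \<Rightarrow> 'b set. range E \<subseteq> sets (borel_on \<Omega>) \<longrightarrow> disjoint_family E \<longrightarrow>
        (\<lambda>i. \<mu> (E i)) sums \<mu> (\<Union>i. E i))"

text \<open>The supremum ranges over all countable Borel partitions of \<open>E\<close>.\<close>

definition total_variation ::
    "'b::topological_space set \<Rightarrow> ('b set \<Rightarrow> real) \<Rightarrow> 'b set \<Rightarrow> ennreal" where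
  "total_variation \<Omega> \<mu> E =
     (SUP P \<in> {P :: nat \<Rightarrow> 'b set.
         range P \<subseteq> sets (borel_on \<Omega>) \<and> disjoint_family P \<and> (\<Union>i. P i) = E}.
       \<Sum>i. ennreal \<bar>\<mu> (P i)\<bar>)"

definition variation_measure ::
    "'b::topological_space set \<Rightarrow> ('b set \<Rightarrow> real) \<Rightarrow> 'b measure" where
  "variation_measure \<Omega> \<mu> = measure_of \<Omega> (sets (borel_on \<Omega>)) (total_variation \<Omega> \<mu>)"

text \<open>Jordan decomposition: \<open>\<mu>\<^sup>+ = (\<bar>\<mu>\<bar> + \<mu>) / 2\<close> and \<open>\<mu>\<^sup>- = (\<bar>\<mu>\<bar> - \<mu>) / 2\<close>.\<close>

definition pos_variation ::
    "'b::topological_space set \<Rightarrow> ('b set \<Rightarrow> real) \<Rightarrow> 'b measure" where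
  "pos_variation \<Omega> \<mu> = measure_of \<Omega> (sets (borel_on \<Omega>))
     (\<lambda>E. ennreal ((measure (variation_measure \<Omega> \<mu>) E + \<mu> E) / 2))"

definition neg_variation ::
    "'b::topological_space set \<Rightarrow> ('b set \<Rightarrow> real) \<Rightarrow> 'b measure" where
  "neg_variation \<Omega> \<mu> = measure_of \<Omega> (sets (borel_on \<Omega>))
     (\<lambda>E. ennreal ((measure (variation_measure \<Omega> \<mu>) E - \<mu> E) / 2))"

definition signed_integral ::
    "'b::topological_space set \<Rightarrow> ('b set \<Rightarrow> real) \<Rightarrow> ('b \<Rightarrow> real) \<Rightarrow> real" where
  "signed_integral \<Omega> \<mu> g =
     (LINT w|pos_variation \<Omega> \<mu>. g w) - (LINT w|neg_variation \<Omega> \<mu>. g w)"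

definition regular_on :: "'b::topological_space set \<Rightarrow> 'b measure \<Rightarrow> bool" where
  "regular_on \<Omega> M \<longleftrightarrow> (\<forall>E \<in> sets M.
     emeasure M E = (INF U \<in> {U. openin (top_of_set \<Omega>) U \<and> E \<subseteq> U}. emeasure M U) \<and>
     emeasure M E = (SUP K \<in> {K. compact K \<and> K \<subseteq> E}. emeasure M K))"

definition radon_measures :: "'b::topological_space set \<Rightarrow> ('b set \<Rightarrow> real) set" where
  "radon_measures \<Omega> = {\<mu>. signed_measure \<Omega> \<mu> \<and> regular_on \<Omega> (variation_measure \<Omega> \<mu>)}"

definition tv_norm :: "'b::topological_space set \<Rightarrow> ('b set \<Rightarrow> real) \<Rightarrow> real" where
  "tv_norm \<Omega> \<mu> = measure (variation_measure \<Omega> \<mu>) \<Omega>"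

definition prob_measures :: "'b::topological_space set \<Rightarrow> 'b measure set" where
  "prob_measures \<Omega> =
     {\<pi>. prob_space \<pi> \<and> sets \<pi> = sets (borel_on \<Omega>) \<and> regular_on \<Omega> \<pi>}"


text \<open>
  A function \<open>X \<rightarrow> \<real>\<close> is represented by its extension by \<open>0\<close> to the whole type, so that
  equality of representatives is equality on \<open>X\<close> and the vector space operations are pointwise.
  The field \<open>fnorm\<close> is only meaningful on \<open>elems\<close>.
\<close>

record 'a fun_space =
  elems :: "('a \<Rightarrow> real) set"
  fnorm :: "('a \<Rightarrow> real) \<Rightarrow> real"

definition fun_on :: "'a set \<Rightarrow> ('a \<Rightarrow> real) \<Rightarrow> 'a \<Rightarrow> real" where
  "fun_on X f = (\<lambda>x. if x \<in> X then f x else 0)"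

definition normed_fun_space :: "'a fun_space \<Rightarrow> bool" where
  "normed_fun_space Z \<longleftrightarrow>
     (\<lambda>x. 0) \<in> elems Z \<and>
     (\<forall>f\<in>elems Z. \<forall>g\<in>elems Z. (\<lambda>x. f x + g x) \<in> elems Z) \<and>
     (\<forall>c. \<forall>f\<in>elems Z. (\<lambda>x. c * f x) \<in> elems Z) \<and>
     (\<forall>f\<in>elems Z. 0 \<le> fnorm Z f) \<and>
     (\<forall>f\<in>elems Z. fnorm Z f = 0 \<longleftrightarrow> f = (\<lambda>x. 0)) \<and>
     (\<forall>c. \<forall>f\<in>elems Z. fnorm Z (\<lambda>x. c * f x) = \<bar>c\<bar> * fnorm Z f) \<and>
     (\<forall>f\<in>elems Z. \<forall>g\<in>elems Z. fnorm Z (\<lambda>x. f x + g x) \<le> fnorm Z f + fnorm Z g)"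

definition isometrically_isomorphic :: "'a fun_space \<Rightarrow> 'c fun_space \<Rightarrow> bool"
    (infix "\<cong>\<^sub>i" 50) where
  "Z \<cong>\<^sub>i Y \<longleftrightarrow> normed_fun_space Z \<and> normed_fun_space Y \<and>
     (\<exists>T. bij_betw T (elems Z) (elems Y) \<and>
       (\<forall>f\<in>elems Z. \<forall>g\<in>elems Z. T (\<lambda>x. f x + g x) = (\<lambda>y. T f y + T g y)) \<and>
       (\<forall>c. \<forall>f\<in>elems Z. T (\<lambda>x. c * f x) = (\<lambda>y. c * T f y)) \<and>
       (\<forall>f\<in>elems Z. fnorm Y (T f) = fnorm Z f))"

definition union_space :: "'i set \<Rightarrow> ('i \<Rightarrow> 'a fun_space) \<Rightarrow> 'a fun_space" where
  "union_space I Z =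
     \<lparr>elems = (\<Union>i\<in>I. elems (Z i)),
      fnorm = (\<lambda>z. INF i\<in>{i\<in>I. z \<in> elems (Z i)}. fnorm (Z i) z)\<rparr>"


definition A_measure ::
    "'a set \<Rightarrow> 'b::topological_space set \<Rightarrow> ('a \<times> 'b \<Rightarrow> real) \<Rightarrow> ('b set \<Rightarrow> real) \<Rightarrow> 'a \<Rightarrow> real"
  where
  "A_measure X \<Omega> \<phi> \<mu> = fun_on X (\<lambda>x. signed_integral \<Omega> \<mu> (\<lambda>w. \<phi> (x, w)))"

definition integral_RKBS ::
    "'a set \<Rightarrow> 'b::topological_space set \<Rightarrow> ('a \<times> 'b \<Rightarrow> real) \<Rightarrow> 'a fun_space" where
  "integral_RKBS X \<Omega> \<phi> =
     \<lparr>elems = A_measure X \<Omega> \<phi> ` radon_measures \<Omega>,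
      fnorm = (\<lambda>f. INF \<mu>\<in>{\<mu> \<in> radon_measures \<Omega>. f = A_measure X \<Omega> \<phi> \<mu>}. tv_norm \<Omega> \<mu>)\<rparr>"

text \<open>Elements of \<open>L\<^sup>p\<close> are represented by functions; everything below respects a.e. equality.\<close>

definition Lp_functions :: "real \<Rightarrow> 'b measure \<Rightarrow> ('b \<Rightarrow> real) set" where
  "Lp_functions p \<pi> =
     {h \<in> borel_measurable \<pi>. integrable \<pi> (\<lambda>w. \<bar>h w\<bar> powr p)}"

definition Lp_norm :: "real \<Rightarrow> 'b measure \<Rightarrow> ('b \<Rightarrow> real) \<Rightarrow> real" where
  "Lp_norm p \<pi> h = (LINT w|\<pi>. \<bar>h w\<bar> powr p) powr (1 / p)"

definition A_density ::
    "'a set \<Rightarrow> ('a \<times> 'b \<Rightarrow> real) \<Rightarrow> 'b measure \<Rightarrow> ('b \<Rightarrow> real) \<Rightarrow> 'a \<Rightarrow> real" where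
  "A_density X \<phi> \<pi> h = fun_on X (\<lambda>x. LINT w|\<pi>. \<phi> (x, w) * h w)"

definition p_norm_RKBS ::
    "'a set \<Rightarrow> ('a \<times> 'b \<Rightarrow> real) \<Rightarrow> real \<Rightarrow> 'b measure \<Rightarrow> 'a fun_space" where
  "p_norm_RKBS X \<phi> p \<pi> =
     \<lparr>elems = A_density X \<phi> \<pi> ` Lp_functions p \<pi>,
      fnorm = (\<lambda>f. INF h\<in>{h \<in> Lp_functions p \<pi>. f = A_density X \<phi> \<pi> h}. Lp_norm p \<pi> h)\<rparr>"

end

theory Submission
  imports Defs "HOL-Probability.Giry_Monad"
begin

text \<open>
  A signed measure \<open>\<mu> \<noteq> 0\<close> has a polar decomposition \<open>d\<mu> = s d\<bar>\<mu>\<bar>\<close> with \<open>\<bar>s\<bar> = 1\<close>. For the probability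
  measure \<open>\<pi> = \<bar>\<mu>\<bar> / \<parallel>\<mu>\<parallel>\<close> the density \<open>h = \<parallel>\<mu>\<parallel> s\<close> represents the same function as \<open>\<mu>\<close>, and since
  \<open>\<bar>h\<bar>\<close> is constant, \<open>\<parallel>h\<parallel>\<^sub>p = \<parallel>\<mu>\<parallel>\<close> for every \<open>p\<close>. Conversely \<open>h \<in> L\<^sup>p(\<pi>)\<close> gives the signed measure
  \<open>d\<mu> = h d\<pi>\<close>, whose norm is \<open>\<parallel>h\<parallel>\<^sub>1 \<le> \<parallel>h\<parallel>\<^sub>p\<close>. So both spaces have the same elements and the same
  norm, and the identity is the isomorphism. Regularity is automatic for finite Borel measures on a
  closed subset of \<open>\<real>\<^sup>n\<close>.
\<close>

subsection \<open>Hahn decomposition\<close>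

text \<open>Finiteness is built into the type: the values of \<open>\<mu>\<close> are real, and the
  Hahn argument relies on this. \<open>M\<close> carries the sigma-algebra.\<close>

definition countably_additive_real :: "'a measure \<Rightarrow> ('a set \<Rightarrow> real) \<Rightarrow> bool" where
  "countably_additive_real M \<mu> \<longleftrightarrow>
     (\<forall>E :: nat \<Rightarrow> 'a set. range E \<subseteq> sets M \<longrightarrow> disjoint_family E \<longrightarrow>
        (\<lambda>i. \<mu> (E i)) sums \<mu> (\<Union>i. E i))"

lemma countably_additive_realD:
  assumes "countably_additive_real M \<mu>" "\<And>i::nat. E i \<in> sets M" "disjoint_family E"
  shows "(\<lambda>i. \<mu> (E i)) sums \<mu> (\<Union>i. E i)"
  using assms by (auto simp: countably_additive_real_def)

lemma countably_additive_real_empty: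
  assumes "countably_additive_real M \<mu>"
  shows "\<mu> {} = 0"
proof -
  have "(\<lambda>i::nat. \<mu> {}) sums \<mu> (\<Union>i::nat. {})"
    by (rule countably_additive_realD[OF assms]) (auto simp: disjoint_family_on_def)
  then show ?thesis
    by (simp add: sums_iff summable_const_iff)
qed

lemma countably_additive_real_Un:
  assumes ca: "countably_additive_real M \<mu>"
    and "A \<in> sets M" "B \<in> sets M" "A \<inter> B = {}"
  shows "\<mu> (A \<union> B) = \<mu> A + \<mu> B"
proof -
  have "(\<lambda>i. \<mu> (binaryset A B i)) sums \<mu> (\<Union>i. binaryset A B i)"
    by (rule countably_additive_realD[OF ca])
      (use assms in \<open>auto simp: binaryset_def disjoint_family_on_def\<close>)
  moreover have "(\<lambda>i. \<mu> (binaryset A B i)) sums (\<mu> A + \<mu> B)"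
    by (rule binaryset_sums) (rule countably_additive_real_empty[OF ca])
  ultimately show ?thesis
    by (simp add: UN_binaryset_eq sums_unique2)
qed

lemma countably_additive_real_Diff:
  assumes "countably_additive_real M \<mu>" "A \<in> sets M" "B \<in> sets M" "B \<subseteq> A"
  shows "\<mu> (A - B) = \<mu> A - \<mu> B"
proof -
  have "\<mu> (B \<union> (A - B)) = \<mu> B + \<mu> (A - B)"
    by (rule countably_additive_real_Un) (use assms in auto)
  moreover have "B \<union> (A - B) = A" using assms by auto
  ultimately show ?thesis by simp
qed

definition negative_set :: "'a measure \<Rightarrow> ('a set \<Rightarrow> real) \<Rightarrow> 'a set \<Rightarrow> bool" where
  "negative_set M \<mu> N \<longleftrightarrow> N \<in> sets M \<and> (\<forall>B\<in>sets M. B \<subseteq> N \<longrightarrow> \<mu> B \<le> 0)"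

text \<open>Some set always reaches half of a supremum. The truncation \<open>min 1\<close> keeps
  the supremum finite, since at this stage \<open>\<mu>\<close> is not known to be bounded above on
  the subsets of \<open>A\<close>.\<close>

lemma ex_half_maximal_subset:
  assumes ca: "countably_additive_real M \<mu>"
  shows "\<exists>B\<in>sets M. B \<subseteq> A \<and> 0 \<le> \<mu> B \<and>
           (\<forall>C\<in>sets M. C \<subseteq> A \<longrightarrow> min 1 (\<mu> C) \<le> 2 * \<mu> B)"
proof -
  define S where "S = (\<lambda>C. min 1 (\<mu> C)) ` {C\<in>sets M. C \<subseteq> A}"
  have e: "\<mu> {} = 0" by (rule countably_additive_real_empty[OF ca])
  have S0: "0 \<in> S" unfolding S_def by (rule image_eqI[of _ _ "{}"]) (auto simp: e)
  have bdd: "bdd_above S" unfolding S_def by (rule bdd_aboveI[of _ 1]) auto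
  have upper: "min 1 (\<mu> C) \<le> Sup S" if "C \<in> sets M" "C \<subseteq> A" for C
    by (rule cSup_upper[OF _ bdd]) (use that in \<open>auto simp: S_def\<close>)
  have "0 \<le> Sup S" by (rule cSup_upper[OF S0 bdd])
  \<comment> \<open>A positive supremum strictly exceeds its half, so some set lies above the half;
    for supremum 0 the empty set serves.\<close>
  then consider "Sup S = 0" | "Sup S / 2 < Sup S" "0 < Sup S" by linarith
  then show ?thesis
  proof cases
    case 1
    then show ?thesis using upper e by (intro bexI[of _ "{}"]) auto
  next
    case 2
    then obtain s where s: "s \<in> S" "Sup S / 2 < s"
      using less_cSupE[of "Sup S / 2" S] S0 by blast
    then obtain B where "B \<in> sets M" "B \<subseteq> A" "Sup S / 2 < min 1 (\<mu> B)"
      unfolding S_def by blast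
    then show ?thesis using upper 2
      by (intro bexI[of _ B]) (auto intro: order_trans[OF upper])
  qed
qed

text \<open>Greedily removing subsets of nearly maximal measure only decreases \<open>\<mu> D\<close>. The removed measures
  are summable, hence tend to \<open>0\<close>, so that no subset of positive measure survives.\<close>

lemma ex_negative_subset:
  assumes ca: "countably_additive_real M \<mu>" and D: "D \<in> sets M"
  shows "\<exists>N. negative_set M \<mu> N \<and> N \<subseteq> D \<and> \<mu> N \<le> \<mu> D"
proof -
  obtain f where f: "\<And>A. f A \<in> sets M" "\<And>A. f A \<subseteq> A" "\<And>A. 0 \<le> \<mu> (f A)"
    "\<And>A C. C \<in> sets M \<Longrightarrow> C \<subseteq> A \<Longrightarrow> min 1 (\<mu> C) \<le> 2 * \<mu> (f A)"
    using ex_half_maximal_subset[OF ca] by metis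
  \<comment> \<open>\<open>R n\<close> is what is left of \<open>D\<close> after \<open>n\<close>
    removals, and \<open>B n\<close> below is the piece removed next.\<close>
  define R where "R = rec_nat D (\<lambda>_ A. A - f A)"
  have R0: "R 0 = D" and RS: "\<And>n. R (Suc n) = R n - f (R n)" by (simp_all add: R_def)
  have anti: "R n \<subseteq> R m" if "m \<le> n" for m n
    using that by (induction rule: dec_induct) (auto simp: RS)
  define B where "B n = f (R n)" for n
  have B: "B n \<in> sets M" "B n \<subseteq> D" "0 \<le> \<mu> (B n)" for n
    using f(1,3) f(2)[of "R n"] anti[of 0 n] R0 by (auto simp: B_def)
  have B_disj: "B m \<inter> B n = {}" if "m < n" for m n
    using anti[of "Suc m" n] that f(2)[of "R n"] by (auto simp: B_def RS)
  have disj: "disjoint_family B"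
    unfolding disjoint_family_on_def by (metis B_disj Int_commute linorder_neqE_nat)
  have R_eq: "R n = D - (\<Union>i<n. B i)" for n
    by (induction n) (auto simp: R0 RS B_def lessThan_Suc)
  have sums: "(\<lambda>i. \<mu> (B i)) sums \<mu> (\<Union>i. B i)"
    using B disj by (intro countably_additive_realD[OF ca])
  define N where "N = D - (\<Union>i. B i)"
  have N: "N \<in> sets M" using D B by (auto simp: N_def)
  have "\<mu> N = \<mu> D - \<mu> (\<Union>i. B i)"
    unfolding N_def using B D by (intro countably_additive_real_Diff[OF ca]) auto
  moreover have "0 \<le> \<mu> (\<Union>i. B i)"
    using sums B(3) by (metis sums_iff suminf_nonneg)
  ultimately have le: "\<mu> N \<le> \<mu> D" by simp
  have "\<mu> C \<le> 0" if C: "C \<in> sets M" "C \<subseteq> N" for C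
  proof -
    have "(\<lambda>i. 2 * \<mu> (B i)) \<longlonglongrightarrow> 2 * 0"
      using sums by (intro tendsto_intros summable_LIMSEQ_zero) (auto simp: sums_iff)
    \<comment> \<open>\<open>C\<close> avoids all removed pieces, so it lies in every remainder
      \<open>R i\<close> and competes in the choice of \<open>B i\<close>.\<close>
    moreover have "min 1 (\<mu> C) \<le> 2 * \<mu> (B i)" for i
      unfolding B_def using C by (intro f(4)) (auto simp: N_def R_eq)
    ultimately have "min 1 (\<mu> C) \<le> 2 * 0"
      by (rule LIMSEQ_le_const[OF _ exI, OF _ allI, OF _ impI])
    then show ?thesis by simp
  qed
  with N le show ?thesis by (auto simp: negative_set_def N_def)
qed

text \<open>Disjointing the union cuts a subset \<open>B\<close> into countably many pieces, each
  inside a single \<open>N n\<close>, so \<open>\<mu> B\<close> is a sum of nonpositive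
  terms.\<close>

lemma negative_set_UN:
  assumes ca: "countably_additive_real M \<mu>" and N: "\<And>n::nat. negative_set M \<mu> (N n)"
  shows "negative_set M \<mu> (\<Union>n. N n)"
proof -
  have "\<mu> B \<le> 0" if B: "B \<in> sets M" "B \<subseteq> (\<Union>n. N n)" for B
  proof -
    define E where "E n = B \<inter> disjointed N n" for n
    have Nm: "\<And>n. N n \<in> sets M" using N by (auto simp: negative_set_def)
    have dm: "disjointed N n \<in> sets M" for n
      using Nm by (auto simp: disjointed_def)
    have "(\<lambda>i. \<mu> (E i)) sums \<mu> (\<Union>i. E i)"
      using B dm disjoint_family_disjointed[of N]
      by (intro countably_additive_realD[OF ca]) (fastforce simp: E_def disjoint_family_on_def)+
    moreover have "(\<Union>i. E i) = B"
      using B by (simp add: E_def UN_disjointed_eq flip: Int_UN_distrib) blast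
    moreover have "\<mu> (E i) \<le> 0" for i
      using N[of i] B(1) dm[of i] disjointed_subset[of N i]
      by (simp add: negative_set_def E_def) (meson le_infI2 sets.Int)
    ultimately show ?thesis
      using sums_le[of "\<lambda>i. \<mu> (E i)" "\<lambda>_. 0" _ 0] by auto
  qed
  then show ?thesis using N by (auto simp: negative_set_def)
qed

text \<open>Inside a negative set monotonicity is reversed, because the removed part
  \<open>N - A\<close> has measure at most 0.\<close>

lemma negative_set_mono:
  assumes ca: "countably_additive_real M \<mu>"
    and "negative_set M \<mu> N" "A \<in> sets M" "A \<subseteq> N"
  shows "\<mu> N \<le> \<mu> A"
proof -
  have "\<mu> (N - A) = \<mu> N - \<mu> A"
    using assms by (intro countably_additive_real_Diff[OF ca]) (auto simp: negative_set_def)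
  moreover have "\<mu> (N - A) \<le> 0" using assms by (auto simp: negative_set_def)
  ultimately show ?thesis by simp
qed

text \<open>A union of negative sets with values approaching the infimum attains it. A set of
  negative measure outside this union would contain a negative set which, once adjoined, pushes the
  value below the infimum.\<close>

theorem Hahn_decomposition:
  assumes ca: "countably_additive_real M \<mu>"
  obtains N where "negative_set M \<mu> N"
    "\<And>B. B \<in> sets M \<Longrightarrow> B \<inter> N = {} \<Longrightarrow> 0 \<le> \<mu> B"
proof -
  define S where "S = \<mu> ` {N. negative_set M \<mu> N}"
  have "negative_set M \<mu> {}"
    by (auto simp: negative_set_def countably_additive_real_empty[OF ca])
  then have S_ne: "S \<noteq> {}" by (auto simp: S_def)
  \<comment> \<open>Otherwise there are negative sets with values below every
    \<open>- real n\<close>, and their union would have a real value below all of these.\<close>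
  have "bdd_below S"
  proof (rule ccontr)
    assume "\<not> bdd_below S"
    then have "\<exists>N. negative_set M \<mu> N \<and> \<mu> N < - real n" for n
      unfolding bdd_below_def S_def by (simp add: not_le)
    then obtain N where N: "\<And>n. negative_set M \<mu> (N n)" "\<And>n. \<mu> (N n) < - real n"
      by metis
    have "\<mu> (\<Union>n. N n) \<le> \<mu> (N n)" for n
      using N by (intro negative_set_mono[OF ca negative_set_UN[OF ca]])
        (auto simp: negative_set_def)
    then have "real n < - \<mu> (\<Union>n. N n)" for n
      using N(2)[of n] by (smt (verit))
    then show False using reals_Archimedean2 by (metis not_less_iff_gr_or_eq)
  qed
  note lower = cInf_lower[OF _ this]
  have "\<exists>N. negative_set M \<mu> N \<and> \<mu> N < Inf S + 1 / real (Suc n)" for n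
    using cInf_lessD[OF S_ne, of "Inf S + 1 / real (Suc n)"] by (auto simp: S_def)
  then obtain N where N: "\<And>n. negative_set M \<mu> (N n)"
      "\<And>n. \<mu> (N n) < Inf S + 1 / real (Suc n)"
    by metis
  define U where "U = (\<Union>n. N n)"
  have U: "negative_set M \<mu> U" unfolding U_def by (rule negative_set_UN[OF ca N(1)])
  have "\<mu> U \<le> \<mu> (N n)" for n
    using N U by (intro negative_set_mono[OF ca U]) (auto simp: U_def negative_set_def)
  then have "\<mu> U \<le> Inf S + inverse (real (Suc n))" for n
    using N(2)[of n] by (simp add: inverse_eq_divide) (smt (verit))
  moreover have "(\<lambda>n. Inf S + inverse (real (Suc n))) \<longlonglongrightarrow> Inf S"
    by (rule LIMSEQ_inverse_real_of_nat_add)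
  ultimately have U_le: "\<mu> U \<le> Inf S"
    by (intro LIMSEQ_le_const) auto
  have "0 \<le> \<mu> B" if B: "B \<in> sets M" "B \<inter> U = {}" for B
  proof -
    obtain A where A: "negative_set M \<mu> A" "A \<subseteq> B" "\<mu> A \<le> \<mu> B"
      using ex_negative_subset[OF ca B(1)] by blast
    \<comment> \<open>The binary union is written as a sequence so that the countable closure
      property applies: index 0 gives \<open>U\<close>, all others \<open>A\<close>.\<close>
    have "negative_set M \<mu> (\<Union>n::nat. if n = 0 then U else A)"
      by (rule negative_set_UN[OF ca]) (use A U in auto)
    moreover have "(\<Union>n::nat. if n = 0 then U else A) = U \<union> A"
      by (auto split: if_splits)
    ultimately have "Inf S \<le> \<mu> (U \<union> A)" by (intro lower) (auto simp: S_def)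
    moreover have "\<mu> (U \<union> A) = \<mu> U + \<mu> A"
      using U A B by (intro countably_additive_real_Un[OF ca]) (auto simp: negative_set_def)
    ultimately show ?thesis using U_le A by linarith
  qed
  with U show ?thesis by (rule that)
qed

subsection \<open>Signed measures with a density\<close>

text \<open>The value 0 off the sigma-algebra follows the convention of
  \<open>signed_measure\<close>, so that signed measures can be compared as plain functions.\<close>

definition density_signed :: "'a measure \<Rightarrow> ('a \<Rightarrow> real) \<Rightarrow> 'a set \<Rightarrow> real" where
  "density_signed M h E = (if E \<in> sets M then LINT w:E|M. h w else 0)"

lemma integrable_restrict_set:
  fixes h :: "'a \<Rightarrow> real"
  assumes "integrable M h" "E \<in> sets M"
  shows "set_integrable M E h"
  using assms unfolding set_integrable_def by (intro integrable_mult_indicator)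

text \<open>The set integral is continuous along the increasing unions
  \<open>\<Union>i<n. E i\<close>, and on each of them finite additivity turns it into a partial
  sum.\<close>

lemma density_signed_sums:
  assumes h: "integrable M h" and E: "\<And>i::nat. E i \<in> sets M" "disjoint_family E"
  shows "(\<lambda>i. density_signed M h (E i)) sums density_signed M h (\<Union>i. E i)"
proof -
  have U: "(\<Union>i\<in>I. E i) \<in> sets M" for I using E by (intro sets.countable_UN) auto
  have "(\<lambda>n. LINT w:(\<Union>i<n. E i)|M. h w) \<longlonglongrightarrow> (LINT w:(\<Union>n. \<Union>i<n. E i)|M. h w)"
    by (intro set_integral_cont_up integrable_restrict_set[OF h] sets.countable_UN)
       (use E(1) in \<open>auto simp: incseq_def intro: less_le_trans\<close>)
  moreover have "(\<Union>n. \<Union>i<n. E i) = (\<Union>i. E i)" by auto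
  moreover have "(LINT w:(\<Union>i<n. E i)|M. h w) = (\<Sum>i<n. LINT w:E i|M. h w)" for n
    using E by (intro set_integral_finite_Union integrable_restrict_set[OF h])
      (auto simp: disjoint_family_on_def)
  ultimately show ?thesis
    using E U by (simp add: sums_def density_signed_def)
qed

lemma signed_measure_density_signed:
  assumes "sets M = sets (borel_on \<Omega>)" "integrable M h"
  shows "signed_measure \<Omega> (density_signed M h)"
  unfolding signed_measure_def
  using density_signed_sums[OF assms(2)] assms(1)
  by (auto simp: density_signed_def image_subset_iff)

lemma emeasure_density_set_integral:
  fixes f :: "'a \<Rightarrow> real"
  assumes f: "integrable M f" "\<And>w. 0 \<le> f w" and E: "E \<in> sets M"
  shows "emeasure (density M (\<lambda>w. ennreal (f w))) E = ennreal (LINT w:E|M. f w)"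
proof -
  have [measurable]: "f \<in> borel_measurable M" using f by auto
  have "emeasure (density M (\<lambda>w. ennreal (f w))) E = (\<integral>\<^sup>+w. ennreal (indicator E w * f w) \<partial>M)"
    using E by (simp add: emeasure_density)
      (intro nn_integral_cong, auto split: split_indicator)
  also have "\<dots> = ennreal (LINT w|M. indicator E w * f w)"
    using integrable_restrict_set[OF f(1) E] f(2)
    by (intro nn_integral_eq_integral) (auto simp: set_integrable_def)
  finally show ?thesis by (simp add: set_lebesgue_integral_def)
qed

lemma measure_density_set_integral:
  fixes f :: "'a \<Rightarrow> real"
  assumes f: "integrable M f" "\<And>w. 0 \<le> f w" and E: "E \<in> sets M"
  shows "measure (density M (\<lambda>w. ennreal (f w))) E = (LINT w:E|M. f w)"
  using emeasure_density_set_integral[OF assms] f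
  by (simp add: measure_def set_lebesgue_integral_def integral_nonneg_AE)

lemma abs_set_integral_le:
  fixes h :: "'a \<Rightarrow> real"
  assumes "integrable M h" "E \<in> sets M"
  shows "\<bar>LINT w:E|M. h w\<bar> \<le> (LINT w:E|M. \<bar>h w\<bar>)"
  using set_integral_norm_bound[OF integrable_restrict_set[OF assms]] by simp

text \<open>No partition exceeds the integral of \<open>\<bar>h w\<bar>\<close> over
  \<open>E\<close>, by the triangle inequality on each piece; splitting \<open>E\<close> by the sign
  of \<open>h\<close> reaches it.\<close>

lemma total_variation_density_signed:
  assumes M: "sets M = sets (borel_on \<Omega>)" and h: "integrable M h" and E: "E \<in> sets M"
  shows "total_variation \<Omega> (density_signed M h) E
       = emeasure (density M (\<lambda>w. ennreal \<bar>h w\<bar>)) E"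
proof (rule antisym)
  let ?D = "density M (\<lambda>w. ennreal \<bar>h w\<bar>)"
  have [measurable]: "h \<in> borel_measurable M" using h by auto
  have D: "emeasure ?D B = ennreal (LINT w:B|M. \<bar>h w\<bar>)" if "B \<in> sets M" for B
    using h that by (intro emeasure_density_set_integral) auto
  show "total_variation \<Omega> (density_signed M h) E \<le> emeasure ?D E"
    unfolding total_variation_def
  proof (rule SUP_least, clarify)
    fix P :: "nat \<Rightarrow> 'a set"
    assume P: "range P \<subseteq> sets (borel_on \<Omega>)" "disjoint_family P"
    have "(\<Sum>i. ennreal \<bar>density_signed M h (P i)\<bar>) \<le> (\<Sum>i. emeasure ?D (P i))"
      using P abs_set_integral_le[OF h]
      by (intro suminf_le) (auto simp: density_signed_def M D intro!: ennreal_leI)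
    also have "\<dots> = emeasure ?D (\<Union>i. P i)"
      using P by (intro suminf_emeasure) (auto simp: M)
    finally show "(\<Sum>i. ennreal \<bar>density_signed M h (P i)\<bar>) \<le> emeasure ?D (\<Union>i. P i)" .
  qed
  define A where "A = E \<inter> {w\<in>space M. 0 \<le> h w}"
  define B where "B = E \<inter> {w\<in>space M. h w < 0}"
  have AB: "A \<in> sets M" "B \<in> sets M" using E by (auto simp: A_def B_def)
  have E_eq: "A \<union> B = E" using sets.sets_into_space[OF E] by (auto simp: A_def B_def)
  have disj: "A \<inter> B = {}" by (auto simp: A_def B_def)
  have A: "(LINT w:A|M. h w) = (LINT w:A|M. \<bar>h w\<bar>)"
    by (intro set_lebesgue_integral_cong AB) (auto simp: A_def)
  have "(LINT w:B|M. - h w) = (LINT w:B|M. \<bar>h w\<bar>)"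
    by (intro set_lebesgue_integral_cong AB) (auto simp: B_def)
  then have B: "- (LINT w:B|M. h w) = (LINT w:B|M. \<bar>h w\<bar>)"
    by (simp add: set_lebesgue_integral_def)
  \<comment> \<open>Partitions are sequences, so the two sign pieces are padded with empty
    sets.\<close>
  let ?P = "binaryset A B"
  have nonneg: "0 \<le> (LINT w:C|M. \<bar>h w\<bar>)" for C
    by (simp add: set_lebesgue_integral_def integral_nonneg_AE)
  have "emeasure ?D E = emeasure ?D A + emeasure ?D B"
    using plus_emeasure[of A ?D B] AB disj E_eq by simp
  also have "\<dots> = ennreal \<bar>density_signed M h A\<bar> + ennreal \<bar>density_signed M h B\<bar>"
    using AB A B nonneg[of A] nonneg[of B] by (simp add: D density_signed_def)
  also have "\<dots> = (\<Sum>i. ennreal \<bar>density_signed M h (?P i)\<bar>)"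
    by (rule suminf_binaryset_eq[symmetric]) (simp add: density_signed_def set_lebesgue_integral_def)
  also have "\<dots> \<le> total_variation \<Omega> (density_signed M h) E"
    unfolding total_variation_def
    by (rule SUP_upper)
      (use AB E_eq disj in \<open>auto simp: M[symmetric] UN_binaryset_eq disjoint_family_on_def
         binaryset_def split: if_splits\<close>)
  finally show "emeasure ?D E \<le> total_variation \<Omega> (density_signed M h) E" .
qed

section \<open>Jordan parts, integral and norm of a signed measure with density\<close>

lemma space_borel_on: "space (borel_on \<Omega>) = \<Omega>"
  by (simp add: space_restrict_space)

lemma sets_borel_on_imp_space:
  assumes "sets M = sets (borel_on \<Omega>)"
  shows "space M = \<Omega>"
  using sets_eq_imp_space_eq[OF assms] by (simp add: space_borel_on)

text \<open>The variation measures are defined by \<open>measure_of\<close>, which returns the given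
  values only if these form a measure. Exhibiting a measure \<open>M\<close> with the same values
  settles this at once.\<close>

lemma measure_of_borel_on:
  assumes M: "sets M = sets (borel_on \<Omega>)"
    and "\<And>E. E \<in> sets M \<Longrightarrow> f E = emeasure M E"
  shows "measure_of \<Omega> (sets (borel_on \<Omega>)) f = M"
proof -
  have sp: "space M = \<Omega>" by (rule sets_borel_on_imp_space[OF M])
  have "measure_of (space M) (sets M) f = measure_of (space M) (sets M) (emeasure M)"
    using sets.space_closed assms(2) by (intro measure_of_eq) (auto simp: sets.sigma_sets_eq)
  then have "measure_of (space M) (sets M) f = M" by (simp only: measure_of_of_measure)
  then show ?thesis by (simp only: sp M)
qed

lemma variation_measure_density_signed:
  assumes M: "sets M = sets (borel_on \<Omega>)" and h: "integrable M h"
  shows "variation_measure \<Omega> (density_signed M h) = density M (\<lambda>w. ennreal \<bar>h w\<bar>)"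
  unfolding variation_measure_def
  using M by (intro measure_of_borel_on) (auto simp: total_variation_density_signed[OF M h])

text \<open>The choices \<open>c = 1\<close> and \<open>c = -1\<close> give the positive and the
  negative variation; \<open>\<bar>c\<bar> \<le> 1\<close> keeps the density nonnegative.\<close>

lemma half_variation_density_signed:
  assumes M: "sets M = sets (borel_on \<Omega>)" and h: "integrable M h" and c: "\<bar>c\<bar> \<le> (1::real)"
  shows "measure_of \<Omega> (sets (borel_on \<Omega>))
      (\<lambda>E. ennreal ((measure (variation_measure \<Omega> (density_signed M h)) E
                      + c * density_signed M h E) / 2))
    = density M (\<lambda>w. ennreal ((\<bar>h w\<bar> + c * h w) / 2))"
proof (rule measure_of_borel_on)
  fix E assume "E \<in> sets (density M (\<lambda>w. ennreal ((\<bar>h w\<bar> + c * h w) / 2)))"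
  then have E: "E \<in> sets M" by simp
  have nonneg: "0 \<le> (\<bar>h w\<bar> + c * h w) / 2" for w
  proof -
    have "\<bar>c * h w\<bar> \<le> \<bar>h w\<bar>"
      using mult_right_mono[OF c, of "\<bar>h w\<bar>"] by (simp add: abs_mult)
    then have "0 \<le> \<bar>h w\<bar> + c * h w" by linarith
    then show ?thesis by simp
  qed
  have "emeasure (density M (\<lambda>w. ennreal ((\<bar>h w\<bar> + c * h w) / 2))) E
      = ennreal (LINT w:E|M. (\<bar>h w\<bar> + c * h w) / 2)"
    using h by (intro emeasure_density_set_integral E nonneg) auto
  also have "(LINT w:E|M. (\<bar>h w\<bar> + c * h w) / 2) = ((LINT w:E|M. \<bar>h w\<bar>) + c * (LINT w:E|M. h w)) / 2"
    using h E integrable_restrict_set[of M "\<lambda>w. \<bar>h w\<bar>" E] integrable_restrict_set[of M "\<lambda>w. c * h w" E]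
    by (simp add: set_integral_add(2))
  finally show "ennreal ((measure (variation_measure \<Omega> (density_signed M h)) E
                      + c * density_signed M h E) / 2)
     = emeasure (density M (\<lambda>w. ennreal ((\<bar>h w\<bar> + c * h w) / 2))) E"
    using E h by (simp add: variation_measure_density_signed[OF M h] density_signed_def
        measure_density_set_integral)
qed (simp add: M)

lemma pos_variation_density_signed:
  assumes M: "sets M = sets (borel_on \<Omega>)" and h: "integrable M h"
  shows "pos_variation \<Omega> (density_signed M h) = density M (\<lambda>w. ennreal ((\<bar>h w\<bar> + h w) / 2))"
  using half_variation_density_signed[OF assms, of 1] by (simp add: pos_variation_def)

lemma neg_variation_density_signed:
  assumes M: "sets M = sets (borel_on \<Omega>)" and h: "integrable M h"
  shows "neg_variation \<Omega> (density_signed M h) = density M (\<lambda>w. ennreal ((\<bar>h w\<bar> - h w) / 2))"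
  using half_variation_density_signed[OF assms, of "-1"] by (simp add: neg_variation_def)

lemma integrable_mult_bounded:
  fixes g h :: "'a \<Rightarrow> real"
  assumes h: "integrable M h" and g: "g \<in> borel_measurable M" "\<And>w. w \<in> space M \<Longrightarrow> \<bar>g w\<bar> \<le> B"
  shows "integrable M (\<lambda>w. g w * h w)"
proof (rule Bochner_Integration.integrable_bound)
  show "integrable M (\<lambda>w. B * \<bar>h w\<bar>)" using h by auto
  show "(\<lambda>w. g w * h w) \<in> borel_measurable M" using h g(1) by auto
  show "AE w in M. norm (g w * h w) \<le> norm (B * \<bar>h w\<bar>)"
  proof (rule AE_I2)
    fix w assume "w \<in> space M"
    then have "\<bar>g w\<bar> \<le> \<bar>B\<bar>" using g(2) by force
    then show "norm (g w * h w) \<le> norm (B * \<bar>h w\<bar>)"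
      by (simp add: abs_mult mult_right_mono)
  qed
qed

text \<open>The Jordan densities \<open>(\<bar>h w\<bar> + h w) / 2\<close> and
  \<open>(\<bar>h w\<bar> - h w) / 2\<close> differ by \<open>h w\<close>. Boundedness of
  \<open>g\<close> makes both integrals finite, so the difference may be taken under the integral
  sign.\<close>

lemma signed_integral_density_signed:
  assumes M: "sets M = sets (borel_on \<Omega>)" and h: "integrable M h"
    and g: "g \<in> borel_measurable M" "\<And>w. w \<in> \<Omega> \<Longrightarrow> \<bar>g w\<bar> \<le> B"
  shows "signed_integral \<Omega> (density_signed M h) g = (LINT w|M. g w * h w)"
proof -
  have sp: "space M = \<Omega>" by (rule sets_borel_on_imp_space[OF M])
  have [measurable]: "h \<in> borel_measurable M" using h by auto
  have int: "integrable M (\<lambda>w. g w * f w)" if "integrable M f" for f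
    using g sp by (intro integrable_mult_bounded[OF that]) auto
  have pos: "(LINT w|density M (\<lambda>w. ennreal (f w)). g w) = (LINT w|M. g w * f w)"
    if "f \<in> borel_measurable M" "\<And>w. 0 \<le> f w" for f
    using that g(1) by (subst integral_density) (auto simp: mult.commute)
  have "signed_integral \<Omega> (density_signed M h) g
      = (LINT w|M. g w * ((\<bar>h w\<bar> + h w) / 2)) - (LINT w|M. g w * ((\<bar>h w\<bar> - h w) / 2))"
    unfolding signed_integral_def pos_variation_density_signed[OF M h]
      neg_variation_density_signed[OF M h]
    by (subst (1 2) pos) auto
  also have "\<dots> = (LINT w|M. g w * ((\<bar>h w\<bar> + h w) / 2) - g w * ((\<bar>h w\<bar> - h w) / 2))"
    using h by (intro Bochner_Integration.integral_diff[symmetric] int) auto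
  also have "\<dots> = (LINT w|M. g w * h w)"
    by (intro Bochner_Integration.integral_cong) (auto simp: field_simps)
  finally show ?thesis .
qed

lemma tv_norm_density_signed:
  assumes M: "sets M = sets (borel_on \<Omega>)" and h: "integrable M h"
  shows "tv_norm \<Omega> (density_signed M h) = (LINT w|M. \<bar>h w\<bar>)"
proof -
  have sp: "space M = \<Omega>" by (rule sets_borel_on_imp_space[OF M])
  have "tv_norm \<Omega> (density_signed M h) = (LINT w:space M|M. \<bar>h w\<bar>)"
    unfolding tv_norm_def variation_measure_density_signed[OF assms] sp
    using h sets.top[of M] by (intro measure_density_set_integral) (auto simp: sp)
  also have "\<dots> = (LINT w|M. \<bar>h w\<bar>)"
    by (intro set_integral_space) (use h in auto)
  finally show ?thesis .
qed

text \<open>\<open>M = \<bar>\<mu>\<bar>\<close> is read off a Hahn decomposition and \<open>h\<close> is its sign.\<close>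

lemma signed_measure_polar:
  assumes "signed_measure \<Omega> \<mu>"
  obtains M h where "finite_measure M" "sets M = sets (borel_on \<Omega>)"
    "h \<in> borel_measurable M" "\<And>w. \<bar>h w\<bar> = 1" "\<mu> = density_signed M h"
proof -
  let ?S = "borel_on \<Omega>"
  have ca: "countably_additive_real ?S \<mu>"
    using assms by (auto simp: signed_measure_def countably_additive_real_def)
  obtain N where N: "negative_set ?S \<mu> N"
    and P: "\<And>B. B \<in> sets ?S \<Longrightarrow> B \<inter> N = {} \<Longrightarrow> 0 \<le> \<mu> B"
    using Hahn_decomposition[OF ca] by metis
  have Ns: "N \<in> sets ?S" using N by (simp add: negative_set_def)
  \<comment> \<open>The sign of \<open>\<mu>\<close> is flipped on the negative set, so both terms
    are nonnegative and \<open>f\<close> is the total variation.\<close>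
  define f where "f E = \<mu> (E - N) - \<mu> (E \<inter> N)" for E
  have neg: "\<mu> (E \<inter> N) \<le> 0" if "E \<in> sets ?S" for E
    using N that by (auto simp: negative_set_def)
  have pos: "0 \<le> \<mu> (E - N)" if "E \<in> sets ?S" for E
    using that Ns by (intro P) auto
  have f_nonneg: "0 \<le> f E" if "E \<in> sets ?S" for E
    using neg[OF that] pos[OF that] by (simp add: f_def)
  have f_sums: "(\<lambda>i. f (E i)) sums f (\<Union>i. E i)"
    if E: "\<And>i::nat. E i \<in> sets ?S" "disjoint_family E" for E
  proof -
    have disj: "E i \<inter> E j = {}" if "i \<noteq> j" for i j
      using E(2) that by (simp add: disjoint_family_on_def)
    have "disjoint_family (\<lambda>i. E i - N)" "disjoint_family (\<lambda>i. E i \<inter> N)"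
      using disj unfolding disjoint_family_on_def by blast+
    then have "(\<lambda>i. \<mu> (E i - N)) sums \<mu> (\<Union>i. E i - N)"
      and "(\<lambda>i. \<mu> (E i \<inter> N)) sums \<mu> (\<Union>i. E i \<inter> N)"
      using countably_additive_realD[OF ca, of "\<lambda>i. E i - N"]
        countably_additive_realD[OF ca, of "\<lambda>i. E i \<inter> N"]
        sets.Diff[OF E(1) Ns] sets.Int[OF E(1) Ns] by simp_all
    moreover have "(\<Union>i. E i - N) = (\<Union>i. E i) - N" "(\<Union>i. E i \<inter> N) = (\<Union>i. E i) \<inter> N"
      by auto
    ultimately show ?thesis
      unfolding f_def by (intro sums_diff) simp_all
  qed
  define M where "M = measure_of \<Omega> (sets ?S) (\<lambda>E. ennreal (f E))"
  have sM: "sets M = sets ?S"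
    unfolding M_def using sets.space_closed[of ?S] sets.sigma_sets_eq[of ?S]
    by (simp add: space_borel_on)
  have eM: "emeasure M E = ennreal (f E)" if "E \<in> sets ?S" for E
    unfolding M_def
  proof (rule emeasure_measure_of_sigma)
    show "sigma_algebra \<Omega> (sets ?S)"
      using sets.sigma_algebra_axioms[of ?S] by (simp add: space_borel_on)
    show "positive (sets ?S) (\<lambda>E. ennreal (f E))"
      by (simp add: positive_def f_def countably_additive_real_empty[OF ca])
    show "countably_additive (sets ?S) (\<lambda>E. ennreal (f E))"
      unfolding countably_additive_def
    proof (intro allI impI)
      fix A :: "nat \<Rightarrow> 'a set" assume A: "range A \<subseteq> sets ?S" "disjoint_family A"
      then have "(\<lambda>i. f (A i)) sums f (\<Union>i. A i)" by (intro f_sums) auto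
      with A show "(\<Sum>i. ennreal (f (A i))) = ennreal (f (\<Union>i. A i))"
        by (intro suminf_ennreal_eq f_nonneg) auto
    qed
  qed (fact that)
  have sp: "space M = \<Omega>" by (rule sets_borel_on_imp_space[OF sM])
  have fin: "finite_measure M"
    by (rule finite_measureI) (use eM[of \<Omega>] sets.top[of ?S] in \<open>simp add: sp space_borel_on\<close>)
  define h where "h w = (if w \<in> N then - 1 else 1 :: real)" for w
  have hm: "h \<in> borel_measurable M"
    unfolding h_def using sets.Int[OF Ns sets.top] sM
    by (intro measurable_If_set) (auto simp: sp space_borel_on)
  have "density_signed M h E = \<mu> E" for E
  proof (cases "E \<in> sets M")
    case True
    interpret finite_measure M by fact
    have E: "E \<in> sets ?S" "E \<inter> N \<in> sets M" "E - N \<in> sets M" using True Ns by (auto simp: sM)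
    have "(LINT w:E|M. h w) = (LINT w|M. indicator (E - N) w - indicator (E \<inter> N) w)"
      unfolding set_lebesgue_integral_def
      by (intro Bochner_Integration.integral_cong) (auto simp: h_def split: split_indicator)
    also have "\<dots> = measure M (E - N) - measure M (E \<inter> N)"
      using E by (simp add: Bochner_Integration.integral_diff less_top[symmetric])
    also have "\<dots> = f (E - N) - f (E \<inter> N)"
      using E f_nonneg by (simp add: measure_def eM sM)
    \<comment> \<open>\<open>f\<close> agrees with \<open>\<mu>\<close> off \<open>N\<close> and
      with \<open>- \<mu>\<close> inside \<open>N\<close>, so the sign of \<open>h\<close> undoes
      the flip.\<close>
    also have "\<dots> = \<mu> (E - N) + \<mu> (E \<inter> N)"
    proof -
      have "(E - N) - N = E - N" "(E - N) \<inter> N = {}" "(E \<inter> N) - N = {}" "(E \<inter> N) \<inter> N = E \<inter> N"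
        by auto
      then show ?thesis
        by (simp only: f_def countably_additive_real_empty[OF ca])
    qed
    also have "\<dots> = \<mu> ((E - N) \<union> (E \<inter> N))"
      using E by (intro countably_additive_real_Un[OF ca, symmetric]) (auto simp: sM)
    finally show ?thesis using True by (simp add: density_signed_def Un_Diff_Int)
  next
    case False
    then show ?thesis using assms by (simp add: density_signed_def signed_measure_def sM)
  qed
  then show ?thesis
    using fin sM hm by (intro that[of M h]) (auto simp: h_def fun_eq_iff)
qed

section \<open>Change of reference measure\<close>

lemma density_signed_absolutely_continuous:
  assumes M: "finite_measure M" and N: "finite_measure N"
    and ac: "absolutely_continuous M N" "sets N = sets M" and h: "integrable N h"
  obtains h' where "integrable M h'" "density_signed N h = density_signed M h'"
proof -
  interpret finite_measure M by (fact M)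
  \<comment> \<open>Finiteness of \<open>N\<close> gives a real-valued version \<open>D\<close> of
    the Radon-Nikodym derivative; the density with respect to \<open>M\<close> is then
    \<open>D x * h x\<close>.\<close>
  obtain D where D[measurable]: "D \<in> borel_measurable M" and
    RN: "AE x in M. RN_deriv M N x = ennreal (D x)" and nonneg: "\<And>x. 0 \<le> D x"
    using real_RN_deriv[OF N ac] by metis
  have "N = density M (RN_deriv M N)"
    by (rule density_RN_deriv[OF ac, symmetric])
  also have "\<dots> = density M (\<lambda>x. ennreal (D x))"
    using RN by (intro density_cong) auto
  finally have N_eq: "N = density M (\<lambda>x. ennreal (D x))" .
  have hm[measurable]: "h \<in> borel_measurable M" using h ac(2) measurable_cong_sets by blast
  have "integrable M (\<lambda>x. D x * h x)"
    using h nonneg unfolding N_eq by (subst (asm) integrable_density) auto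
  moreover have "(LINT w:E|N. h w) = (LINT w:E|M. D w * h w)" if "E \<in> sets M" for E
  proof -
    have "(LINT w:E|N. h w) = (LINT w|M. D w * (indicator E w * h w))"
      using that nonneg unfolding N_eq set_lebesgue_integral_def
      by (subst integral_density) auto
    also have "\<dots> = (LINT w:E|M. D w * h w)"
      by (simp add: set_lebesgue_integral_def mult.left_commute)
    finally show ?thesis .
  qed
  then have "density_signed N h = density_signed M (\<lambda>x. D x * h x)"
    by (auto simp: density_signed_def ac(2))
  ultimately show ?thesis by (rule that)
qed

text \<open>The sum of the two measures is finite, and its null sets are null for both.\<close>

lemma ex_dominating_measure:
  assumes M: "finite_measure M" and N: "finite_measure N" and sets: "sets N = sets M"
  obtains S where "finite_measure S" "sets S = sets M"
    "absolutely_continuous S M" "absolutely_continuous S N"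
proof -
  define S where "S = measure_of (space M) (sets M) (\<lambda>E. emeasure M E + emeasure N E)"
  have sS: "sets S = sets M"
    by (simp add: S_def sets.space_closed sets.sigma_sets_eq)
  have eS: "emeasure S E = emeasure M E + emeasure N E" if "E \<in> sets M" for E
    unfolding S_def
  proof (rule emeasure_measure_of_sigma)
    show "countably_additive (sets M) (\<lambda>E. emeasure M E + emeasure N E)"
      unfolding countably_additive_def
    proof (intro allI impI)
      fix A :: "nat \<Rightarrow> 'a set" assume A: "range A \<subseteq> sets M" "disjoint_family A"
      then show "(\<Sum>i. emeasure M (A i) + emeasure N (A i)) = emeasure M (\<Union>i. A i) + emeasure N (\<Union>i. A i)"
        by (subst suminf_add[symmetric]) (auto simp: suminf_emeasure sets)
    qed
  qed (auto simp: positive_def that sets.sigma_algebra_axioms)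
  have "finite_measure S"
    by (rule finite_measureI)
      (use finite_measure.emeasure_finite[OF M] finite_measure.emeasure_finite[OF N]
       in \<open>simp add: sets_eq_imp_space_eq[OF sS] eS\<close>)
  moreover have "absolutely_continuous S M" "absolutely_continuous S N"
    by (auto simp: absolutely_continuous_def null_sets_def sS eS sets)
  ultimately show ?thesis using sS by (intro that) auto
qed

text \<open>Over one reference measure, adding signed measures means adding densities, and the norm
  inequality becomes a pointwise triangle inequality. The two polar decompositions have their own
  reference measures, so both are moved to a dominating one.\<close>

lemma signed_measures_common_density:
  assumes "signed_measure \<Omega> \<mu>" "signed_measure \<Omega> \<nu>"
  obtains M h k where "sets M = sets (borel_on \<Omega>)" "integrable M h" "integrable M k"
    "\<mu> = density_signed M h" "\<nu> = density_signed M k"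
proof -
  obtain M1 h1 where 1: "finite_measure M1" "sets M1 = sets (borel_on \<Omega>)"
    "h1 \<in> borel_measurable M1" "\<And>w. \<bar>h1 w\<bar> = 1" "\<mu> = density_signed M1 h1"
    using signed_measure_polar[OF assms(1)] by metis
  obtain M2 h2 where 2: "finite_measure M2" "sets M2 = sets (borel_on \<Omega>)"
    "h2 \<in> borel_measurable M2" "\<And>w. \<bar>h2 w\<bar> = 1" "\<nu> = density_signed M2 h2"
    using signed_measure_polar[OF assms(2)] by metis
  obtain S where S: "finite_measure S" "sets S = sets M1"
    "absolutely_continuous S M1" "absolutely_continuous S M2"
    using ex_dominating_measure[OF 1(1) 2(1)] 1(2) 2(2) by metis
  have int: "integrable M1 h1" "integrable M2 h2"
    using 1 2 by (auto intro!: finite_measure.integrable_const_bound[where B = 1])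
  obtain h where h: "integrable S h" "density_signed M1 h1 = density_signed S h"
    using density_signed_absolutely_continuous[OF S(1) 1(1) S(3) _ int(1)] S(2) by metis
  obtain k where k: "integrable S k" "density_signed M2 h2 = density_signed S k"
    using density_signed_absolutely_continuous[OF S(1) 2(1) S(4) _ int(2)] S(2) 1(2) 2(2) by metis
  show ?thesis using that[of S h k] h k S 1 2 by simp
qed

subsection \<open>Regularity of finite measures\<close>

text \<open>The image of \<open>M\<close> on the whole space is a finite Borel measure on a complete
  separable metric space, hence regular; since \<open>\<Omega>\<close> is Borel, this restricts to
  \<open>\<Omega>\<close>.\<close>

lemma regular_on_finite_measure:
  fixes \<Omega> :: "'b::{second_countable_topology, complete_space} set"
  assumes \<Omega>: "\<Omega> \<in> sets borel" and M: "finite_measure M" "sets M = sets (borel_on \<Omega>)"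
  shows "regular_on \<Omega> M"
proof -
  define N where "N = distr M borel (\<lambda>w. w)"
  have sp: "space M = \<Omega>" by (rule sets_borel_on_imp_space[OF M(2)])
  have id: "(\<lambda>w. w) \<in> measurable M borel"
    using measurable_restrict_space1[OF measurable_ident, of borel \<Omega>]
    by (simp add: measurable_cong_sets[OF M(2) refl] id_def)
  have N: "emeasure N B = emeasure M (B \<inter> \<Omega>)" if "B \<in> sets borel" for B
    using that unfolding N_def by (subst emeasure_distr[OF id]) (auto simp: sp)
  have sN: "sets N = sets borel" by (simp add: N_def)
  have fin: "emeasure N (space N) \<noteq> \<infinity>"
    using finite_measure.emeasure_finite[OF finite_measure.finite_measure_distr[OF M(1) id]]
    by (simp add: N_def)
  have sets: "E \<in> sets M \<longleftrightarrow> E \<in> sets borel \<and> E \<subseteq> \<Omega>" for E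
    using \<Omega> by (auto simp: M(2) sets_restrict_space_iff)
  show ?thesis
    unfolding regular_on_def
  proof (intro ballI conjI)
    fix E assume "E \<in> sets M"
    then have E: "E \<in> sets borel" "E \<subseteq> \<Omega>" by (auto simp: sets)
    have NM: "emeasure N K = emeasure M K" if "K \<in> sets borel" "K \<subseteq> \<Omega>" for K
      using that by (simp add: N Int_absorb2)
    show "emeasure M E = (INF U \<in> {U. openin (top_of_set \<Omega>) U \<and> E \<subseteq> U}. emeasure M U)"
    proof (rule antisym)
      show "emeasure M E \<le> (INF U \<in> {U. openin (top_of_set \<Omega>) U \<and> E \<subseteq> U}. emeasure M U)"
        using \<Omega> by (intro INF_greatest emeasure_mono) (auto simp: sets openin_open)
      \<comment> \<open>An open \<open>U\<close> of the whole space has the relatively open trace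
        \<open>U \<inter> \<Omega>\<close>, whose mass is the same because \<open>N\<close> is
        carried by \<open>\<Omega>\<close>.\<close>
      have "(INF U \<in> {U. openin (top_of_set \<Omega>) U \<and> E \<subseteq> U}. emeasure M U)
          \<le> (INF U \<in> {U. E \<subseteq> U \<and> open U}. emeasure N U)"
      proof (rule INF_mono)
        fix U assume "U \<in> {U. E \<subseteq> U \<and> open U}"
        then show "\<exists>V\<in>{V. openin (top_of_set \<Omega>) V \<and> E \<subseteq> V}. emeasure M V \<le> emeasure N U"
          using E(2) by (intro bexI[of _ "U \<inter> \<Omega>"]) (auto simp: N openin_open)
      qed
      also have "\<dots> = emeasure M E"
        using outer_regular[OF sN fin E(1)] NM[OF E] by simp
      finally show "(INF U \<in> {U. openin (top_of_set \<Omega>) U \<and> E \<subseteq> U}. emeasure M U) \<le> emeasure M E" .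
    qed
    have "emeasure M E = (SUP K \<in> {K. K \<subseteq> E \<and> compact K}. emeasure N K)"
      using inner_regular[OF sN fin E(1)] NM[OF E] by simp
    also have "\<dots> = (SUP K \<in> {K. compact K \<and> K \<subseteq> E}. emeasure M K)"
      using E by (intro SUP_cong) (auto intro!: NM borel_compact)
    finally show "emeasure M E = (SUP K \<in> {K. compact K \<and> K \<subseteq> E}. emeasure M K)" .
  qed
qed

text \<open>In a polar decomposition the density has absolute value 1, so the variation measure is
  the finite measure \<open>M\<close> itself, and that one is regular.\<close>

lemma radon_measures_eq:
  fixes \<Omega> :: "'b::{second_countable_topology, complete_space} set"
  assumes \<Omega>: "\<Omega> \<in> sets borel"
  shows "radon_measures \<Omega> = {\<mu>. signed_measure \<Omega> \<mu>}"
proof -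
  have "regular_on \<Omega> (variation_measure \<Omega> \<mu>)" if \<mu>: "signed_measure \<Omega> \<mu>" for \<mu>
  proof -
    obtain M h where M: "finite_measure M" "sets M = sets (borel_on \<Omega>)"
      "h \<in> borel_measurable M" "\<And>w. \<bar>h w\<bar> = 1" "\<mu> = density_signed M h"
      using signed_measure_polar[OF \<mu>] by metis
    have "integrable M h"
      using M by (auto intro!: finite_measure.integrable_const_bound[where B = 1])
    then have "variation_measure \<Omega> \<mu> = M"
      using M by (simp add: variation_measure_density_signed density_1)
    then show ?thesis using regular_on_finite_measure[OF \<Omega> M(1,2)] by simp
  qed
  then show ?thesis by (auto simp: radon_measures_def)
qed

subsection \<open>\<open>L\<^sup>p\<close> functions on a probability space\<close>

text \<open>Young's inequality with second factor 1. The conjugate exponent is infinite for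
  \<open>p = 1\<close>, so that case is split off; there both sides are equal.\<close>

lemma le_powr_div_plus:
  fixes x p :: real
  assumes "0 \<le> x" "1 \<le> p"
  shows "x \<le> x powr p / p + (1 - 1 / p)"
proof (cases "p = 1")
  case False
  then have p: "1 < p" using assms by simp
  define q where "q = p / (p - 1)"
  have q: "1 < q" "1 / q = 1 - 1 / p"
    using p by (simp_all add: q_def diff_divide_distrib)
  then have "1 / p + 1 / q = 1" by simp
  from Youngs_inequality[OF p q(1) this assms(1), of 1] show ?thesis
    by (simp add: q)
qed (use assms in auto)

lemma Lp_functions_integrable:
  assumes "finite_measure \<pi>" "1 \<le> p" "h \<in> Lp_functions p \<pi>"
  shows "integrable \<pi> h"
proof (rule Bochner_Integration.integrable_bound)
  interpret finite_measure \<pi> by fact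
  show "integrable \<pi> (\<lambda>w. \<bar>h w\<bar> powr p / p + (1 - 1 / p))"
    using assms by (auto simp: Lp_functions_def)
  show "h \<in> borel_measurable \<pi>" using assms by (simp add: Lp_functions_def)
  show "AE w in \<pi>. norm (h w) \<le> norm (\<bar>h w\<bar> powr p / p + (1 - 1 / p))"
  proof (rule AE_I2)
    fix w
    show "norm (h w) \<le> norm (\<bar>h w\<bar> powr p / p + (1 - 1 / p))"
      using order_trans[OF le_powr_div_plus[OF abs_ge_zero assms(2), of "h w"] abs_ge_self]
      by (simp only: real_norm_def)
  qed
qed

text \<open>Young's inequality \<open>x \<le> x powr p / p + 1 - 1 / p\<close> is integrated with \<open>x\<close> normalised to
  \<open>\<bar>h w\<bar> / \<parallel>h\<parallel>\<^sub>p\<close>.\<close>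

lemma L1_le_Lp_norm:
  assumes "prob_space \<pi>" and p: "1 \<le> p" and h: "h \<in> Lp_functions p \<pi>"
  shows "(LINT w|\<pi>. \<bar>h w\<bar>) \<le> Lp_norm p \<pi> h"
proof -
  interpret prob_space \<pi> by fact
  have hm[measurable]: "h \<in> borel_measurable \<pi>" and int: "integrable \<pi> (\<lambda>w. \<bar>h w\<bar> powr p)"
    using h by (auto simp: Lp_functions_def)
  have h1: "integrable \<pi> h" by (rule Lp_functions_integrable[OF _ p h]) unfold_locales
  define I where "I = (LINT w|\<pi>. \<bar>h w\<bar> powr p)"
  have I_nonneg: "0 \<le> I" by (simp add: I_def integral_nonneg_AE)
  show ?thesis
  proof (cases "I = 0")
    \<comment> \<open>Normalising by the norm is impossible here, but \<open>h\<close> vanishes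
      almost everywhere.\<close>
    case True
    then have "AE w in \<pi>. \<bar>h w\<bar> powr p = 0"
      using integral_nonneg_eq_0_iff_AE[OF int] by (simp add: I_def)
    then have "(LINT w|\<pi>. \<bar>h w\<bar>) = (LINT w|\<pi>. 0)"
      by (intro integral_cong_AE) (auto simp: powr_eq_0_iff)
    then show ?thesis by (simp add: Lp_norm_def)
  next
    case False
    define N where "N = Lp_norm p \<pi> h"
    have N: "0 < N" "N powr p = I"
      using False I_nonneg p by (auto simp: N_def Lp_norm_def I_def[symmetric] powr_powr)
    have le: "\<bar>h w\<bar> / N \<le> \<bar>h w\<bar> powr p / I / p + (1 - 1 / p)" for w
      using le_powr_div_plus[of "\<bar>h w\<bar> / N" p] N p by (simp add: powr_divide)
    have "(LINT w|\<pi>. \<bar>h w\<bar> / N) \<le> (LINT w|\<pi>. \<bar>h w\<bar> powr p / I / p + (1 - 1 / p))"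
      using h1 int by (intro integral_mono le) auto
    \<comment> \<open>After normalisation only the weights \<open>1 / p\<close> and
      \<open>1 - 1 / p\<close> remain, the latter because the total mass is 1.\<close>
    also have "\<dots> = I / I / p + (1 - 1 / p)"
      using int by (subst Bochner_Integration.integral_add) (auto simp: I_def prob_space)
    also have "\<dots> = 1" using False by simp
    finally show ?thesis using N by (simp add: N_def[symmetric] divide_le_eq)
  qed
qed

lemma Lp_norm_const_abs:
  assumes "prob_space \<pi>" "1 \<le> p" "0 \<le> c" "\<And>w. \<bar>h w\<bar> = c"
  shows "Lp_norm p \<pi> h = c"
proof -
  interpret prob_space \<pi> by fact
  show ?thesis using assms by (simp add: Lp_norm_def prob_space powr_powr)
qed

subsection \<open>Quotient norms on function spaces\<close>

lemma quotient_norm_less: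
  fixes t :: "'m \<Rightarrow> real"
  assumes "f \<in> A ` R" "0 < e"
  shows "\<exists>\<mu>\<in>R. f = A \<mu> \<and> t \<mu> < (INF \<mu>\<in>{\<mu>\<in>R. f = A \<mu>}. t \<mu>) + e"
proof -
  have "t ` {\<mu>\<in>R. f = A \<mu>} \<noteq> {}" using assms(1) by auto
  from cInf_lessD[OF this, of "(INF \<mu>\<in>{\<mu>\<in>R. f = A \<mu>}. t \<mu>) + e"] assms(2)
  show ?thesis by auto
qed

lemma quotient_norm_le:
  fixes t :: "'m \<Rightarrow> real"
  assumes "\<And>\<mu>. \<mu> \<in> R \<Longrightarrow> 0 \<le> t \<mu>" "\<mu> \<in> R" "f = A \<mu>"
  shows "(INF \<mu>\<in>{\<mu>\<in>R. f = A \<mu>}. t \<mu>) \<le> t \<mu>"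
  using assms by (intro cINF_lower bdd_belowI[of _ 0]) auto

text \<open>\<open>R\<close> may be a bare set: what enters is that sums and multiples of
  represented functions have representatives of controlled size. The bound on point values by
  \<open>B * t \<mu>\<close> gives definiteness.\<close>

lemma normed_fun_space_quotient:
  fixes A :: "'m \<Rightarrow> 'a \<Rightarrow> real" and t :: "'m \<Rightarrow> real"
  assumes ne: "R \<noteq> {}"
    and add: "\<And>\<mu> \<nu>. \<mu> \<in> R \<Longrightarrow> \<nu> \<in> R \<Longrightarrow>
      \<exists>\<rho>\<in>R. A \<rho> = (\<lambda>x. A \<mu> x + A \<nu> x) \<and> t \<rho> \<le> t \<mu> + t \<nu>"
    and scale: "\<And>c \<mu>. \<mu> \<in> R \<Longrightarrow> \<exists>\<rho>\<in>R. A \<rho> = (\<lambda>x. c * A \<mu> x) \<and> t \<rho> \<le> \<bar>c\<bar> * t \<mu>"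
    and nonneg: "\<And>\<mu>. \<mu> \<in> R \<Longrightarrow> 0 \<le> t \<mu>"
    and bound: "\<And>\<mu> x. \<mu> \<in> R \<Longrightarrow> \<bar>A \<mu> x\<bar> \<le> B * t \<mu>"
  shows "normed_fun_space \<lparr>elems = A ` R, fnorm = (\<lambda>f. INF \<mu>\<in>{\<mu>\<in>R. f = A \<mu>}. t \<mu>)\<rparr>"
proof -
  define n where "n f = (INF \<mu>\<in>{\<mu>\<in>R. f = A \<mu>}. t \<mu>)" for f
  have n_le: "n (A \<mu>) \<le> t \<mu>" if "\<mu> \<in> R" for \<mu>
    unfolding n_def by (rule quotient_norm_le[OF nonneg that refl])
  have n_less: "\<exists>\<mu>\<in>R. f = A \<mu> \<and> t \<mu> < n f + e" if "f \<in> A ` R" "0 < e" for f e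
    unfolding n_def by (rule quotient_norm_less[OF that])
  have n_nonneg: "0 \<le> n f" if "f \<in> A ` R" for f
    unfolding n_def
  proof (rule cINF_greatest)
    show "{\<mu>\<in>R. f = A \<mu>} \<noteq> {}" using that by blast
  qed (use nonneg in simp)
  have scale_mem: "(\<lambda>x. c * f x) \<in> A ` R" if f: "f \<in> A ` R" for c f
  proof -
    obtain \<mu> where \<mu>: "\<mu> \<in> R" "f = A \<mu>" using f by blast
    obtain \<rho> where "\<rho> \<in> R" "A \<rho> = (\<lambda>x. c * A \<mu> x)" using scale[OF \<mu>(1)] by blast
    then show ?thesis unfolding \<mu>(2) by (metis imageI)
  qed
  have add_mem: "(\<lambda>x. f x + g x) \<in> A ` R" if fg: "f \<in> A ` R" "g \<in> A ` R" for f g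
  proof -
    obtain \<mu> \<nu> where \<mu>: "\<mu> \<in> R" "f = A \<mu>" and \<nu>: "\<nu> \<in> R" "g = A \<nu>" using fg by blast
    obtain \<rho> where "\<rho> \<in> R" "A \<rho> = (\<lambda>x. A \<mu> x + A \<nu> x)" using add[OF \<mu>(1) \<nu>(1)] by blast
    then show ?thesis unfolding \<mu>(2) \<nu>(2) by (metis imageI)
  qed
  have zero_mem: "(\<lambda>x. 0) \<in> A ` R"
  proof -
    obtain \<mu> where "\<mu> \<in> R" using ne by auto
    from scale_mem[of "A \<mu>" 0] this show ?thesis by auto
  qed
  have scale_le: "n (\<lambda>x. c * f x) \<le> \<bar>c\<bar> * n f" if f: "f \<in> A ` R" for c f
  proof (rule field_le_epsilon)
    fix e :: real assume e: "0 < e"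
    \<comment> \<open>The denominator \<open>\<bar>c\<bar> + 1\<close> absorbs the factor
      \<open>\<bar>c\<bar>\<close> and stays positive for \<open>c = 0\<close>.\<close>
    obtain \<mu> where \<mu>: "\<mu> \<in> R" "f = A \<mu>" "t \<mu> < n f + e / (\<bar>c\<bar> + 1)"
      using n_less[OF f, of "e / (\<bar>c\<bar> + 1)"] e by auto
    obtain \<rho> where \<rho>: "\<rho> \<in> R" "A \<rho> = (\<lambda>x. c * A \<mu> x)" "t \<rho> \<le> \<bar>c\<bar> * t \<mu>"
      using scale[OF \<mu>(1)] by blast
    have "n (\<lambda>x. c * f x) \<le> \<bar>c\<bar> * t \<mu>" using n_le[OF \<rho>(1)] \<rho> \<mu> by simp
    also have "\<dots> \<le> \<bar>c\<bar> * (n f + e / (\<bar>c\<bar> + 1))" using \<mu>(3) by (intro mult_left_mono) auto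
    also have "\<dots> = \<bar>c\<bar> * n f + e * (\<bar>c\<bar> / (\<bar>c\<bar> + 1))" by (simp add: algebra_simps)
    also have "\<dots> \<le> \<bar>c\<bar> * n f + e * 1"
      using e by (intro add_left_mono mult_left_mono) (auto simp: divide_simps)
    finally show "n (\<lambda>x. c * f x) \<le> \<bar>c\<bar> * n f + e" by simp
  qed
  have n_zero: "n (\<lambda>x. 0) = 0"
    using scale_le[OF zero_mem, of 0] n_nonneg[OF zero_mem] by simp
  have scale_eq: "n (\<lambda>x. c * f x) = \<bar>c\<bar> * n f" if f: "f \<in> A ` R" for c f
  proof (cases "c = 0")
    case False
    \<comment> \<open>The reverse inequality is the one just proved, applied to the multiple
      \<open>c * f x\<close> with factor \<open>1 / c\<close>.\<close>
    have "n f \<le> \<bar>1 / c\<bar> * n (\<lambda>x. c * f x)"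
      using scale_le[OF scale_mem[OF f, of c], of "1 / c"] False by simp
    then have "\<bar>c\<bar> * n f \<le> n (\<lambda>x. c * f x)"
      using False by (simp add: field_simps)
    with scale_le[OF f, of c] show ?thesis by simp
  qed (simp add: n_zero)
  have add_le: "n (\<lambda>x. f x + g x) \<le> n f + n g" if f: "f \<in> A ` R" and g: "g \<in> A ` R" for f g
  proof (rule field_le_epsilon)
    fix e :: real assume e: "0 < e"
    obtain \<mu> where \<mu>: "\<mu> \<in> R" "f = A \<mu>" "t \<mu> < n f + e / 2"
      using n_less[OF f, of "e / 2"] e by auto
    obtain \<nu> where \<nu>: "\<nu> \<in> R" "g = A \<nu>" "t \<nu> < n g + e / 2"
      using n_less[OF g, of "e / 2"] e by auto
    obtain \<rho> where \<rho>: "\<rho> \<in> R" "A \<rho> = (\<lambda>x. A \<mu> x + A \<nu> x)" "t \<rho> \<le> t \<mu> + t \<nu>"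
      using add[OF \<mu>(1) \<nu>(1)] by blast
    show "n (\<lambda>x. f x + g x) \<le> n f + n g + e"
      using n_le[OF \<rho>(1)] \<rho> \<mu> \<nu> by simp
  qed
  have definite: "f = (\<lambda>x. 0)" if f: "f \<in> A ` R" and "n f = 0" for f
  proof
    fix x
    \<comment> \<open>Since \<open>n f = 0\<close>, there are representatives of arbitrarily small
      size; \<open>\<bar>B\<bar>\<close> replaces \<open>B\<close>, whose sign is
      unspecified.\<close>
    have le: "\<bar>f x\<bar> \<le> \<bar>B\<bar> * e" if e: "0 < e" for e
    proof -
      obtain \<mu> where \<mu>: "\<mu> \<in> R" "f = A \<mu>" "t \<mu> < e"
        using n_less[OF f e] \<open>n f = 0\<close> by auto
      have "\<bar>f x\<bar> \<le> B * t \<mu>" using bound \<mu> by simp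
      also have "\<dots> \<le> \<bar>B\<bar> * e"
        using \<mu> nonneg[OF \<mu>(1)] by (intro mult_mono) auto
      finally show ?thesis .
    qed
    have "\<bar>f x\<bar> \<le> 0 + e" if "0 < e" for e
    proof -
      have "\<bar>f x\<bar> \<le> \<bar>B\<bar> * (e / (\<bar>B\<bar> + 1))" using that by (intro le) auto
      also have "\<dots> = e * (\<bar>B\<bar> / (\<bar>B\<bar> + 1))" by simp
      also have "\<dots> \<le> e * 1" using that by (intro mult_left_mono) (auto simp: divide_simps)
      finally show ?thesis by simp
    qed
    then have "\<bar>f x\<bar> \<le> 0" by (rule field_le_epsilon)
    then show "f x = 0" by simp
  qed
  define Z where "Z = \<lparr>elems = A ` R, fnorm = n\<rparr>"
  have Z: "elems Z = A ` R" "fnorm Z = n" by (simp_all add: Z_def)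
  have "normed_fun_space Z"
    unfolding normed_fun_space_def Z
  proof (intro conjI ballI allI)
    show "n f = 0 \<longleftrightarrow> f = (\<lambda>x. 0)" if "f \<in> A ` R" for f
      using definite[OF that] n_zero by blast
  qed (fact zero_mem add_mem scale_mem n_nonneg scale_eq add_le)+
  then show ?thesis by (simp only: Z_def n_def[abs_def])
qed

text \<open>The norm axioms evaluate \<open>fnorm\<close> on \<open>elems\<close> only, so they
  transfer from \<open>Z\<close> to \<open>Y\<close>. Thus the union, which is not visibly a vector
  space, inherits them from the integral space.\<close>

lemma isometrically_isomorphic_identity:
  assumes Z: "normed_fun_space Z" and el: "elems Y = elems Z"
    and n: "\<And>f. f \<in> elems Z \<Longrightarrow> fnorm Y f = fnorm Z f"
  shows "Z \<cong>\<^sub>i Y"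
proof -
  have "normed_fun_space Y"
    using Z unfolding normed_fun_space_def by (simp add: el n)
  then show ?thesis
    unfolding isometrically_isomorphic_def using Z n
    by (intro conjI exI[of _ id]) (auto simp: el)
qed

subsection \<open>Spaces generated by a bounded kernel\<close>

text \<open>Off a suitable compact set the absolute value is below 1, and on that set continuity
  gives a bound.\<close>

lemma C0_bounded:
  assumes "f \<in> C0 S"
  obtains B where "0 \<le> B" "\<And>z. z \<in> S \<Longrightarrow> \<bar>f z\<bar> \<le> B"
proof -
  obtain K where K: "compact K" "K \<subseteq> S" "\<And>z. z \<in> S - K \<Longrightarrow> \<bar>f z\<bar> < 1"
    using assms by (auto simp: C0_def dest!: spec[of _ "1::real"])
  have "continuous_on K f"
    using assms K(2) by (auto simp: C0_def intro: continuous_on_subset)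
  then have "bounded (f ` K)"
    using compact_continuous_image[OF _ K(1)] compact_imp_bounded by blast
  then obtain C where C: "\<And>z. z \<in> K \<Longrightarrow> \<bar>f z\<bar> \<le> C"
    unfolding bounded_iff by auto
  show ?thesis
  proof (rule that[of "max 1 C"])
    fix z assume "z \<in> S"
    then show "\<bar>f z\<bar> \<le> max 1 C" using C[of z] K(3)[of z] by (cases "z \<in> K") force+
  qed simp
qed

text \<open>\<open>domain_ne\<close> provides a probability measure;
  \<open>kernel_measurable\<close> and \<open>kernel_bounded\<close> make the kernel integrable
  against every integrable density.\<close>

locale bounded_kernel =
  fixes X :: "'a set" and \<Omega> :: "'b::{second_countable_topology, complete_space} set"
    and \<phi> :: "'a \<times> 'b \<Rightarrow> real" and B :: real
  assumes borel_domain: "\<Omega> \<in> sets borel" and domain_ne: "\<Omega> \<noteq> {}"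
    and kernel_measurable: "\<And>x. x \<in> X \<Longrightarrow> (\<lambda>w. \<phi> (x, w)) \<in> borel_measurable (borel_on \<Omega>)"
    and kernel_bounded: "\<And>x w. x \<in> X \<Longrightarrow> w \<in> \<Omega> \<Longrightarrow> \<bar>\<phi> (x, w)\<bar> \<le> B"
    and bound_nonneg: "0 \<le> B"
begin

lemma kernel_measurable':
  assumes "sets M = sets (borel_on \<Omega>)" "x \<in> X"
  shows "(\<lambda>w. \<phi> (x, w)) \<in> borel_measurable M"
  using kernel_measurable[OF assms(2)] measurable_cong_sets[OF assms(1) refl] by blast

lemma integrable_kernel:
  assumes M: "sets M = sets (borel_on \<Omega>)" and h: "integrable M h" and x: "x \<in> X"
  shows "integrable M (\<lambda>w. \<phi> (x, w) * h w)"
  using kernel_bounded[OF x]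
  by (intro integrable_mult_bounded[OF h kernel_measurable'[OF M x]]) (auto simp: sets_borel_on_imp_space[OF M])

lemma A_measure_density_signed:
  assumes M: "sets M = sets (borel_on \<Omega>)" and h: "integrable M h"
  shows "A_measure X \<Omega> \<phi> (density_signed M h) = A_density X \<phi> M h"
  unfolding A_measure_def A_density_def fun_on_def
  using signed_integral_density_signed[OF M h kernel_measurable'[OF M] kernel_bounded]
  by (auto simp: fun_eq_iff)

lemma abs_A_density_le:
  assumes M: "sets M = sets (borel_on \<Omega>)" and h: "integrable M h"
  shows "\<bar>A_density X \<phi> M h x\<bar> \<le> B * (LINT w|M. \<bar>h w\<bar>)"
proof (cases "x \<in> X")
  case True
  have "\<bar>LINT w|M. \<phi> (x, w) * h w\<bar> \<le> (LINT w|M. \<bar>\<phi> (x, w) * h w\<bar>)"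
    by (rule integral_abs_bound)
  also have "\<dots> \<le> (LINT w|M. B * \<bar>h w\<bar>)"
  proof (rule integral_mono)
    show "integrable M (\<lambda>w. \<bar>\<phi> (x, w) * h w\<bar>)"
      using integrable_kernel[OF M h True] by (rule integrable_abs)
    fix w assume "w \<in> space M"
    then show "\<bar>\<phi> (x, w) * h w\<bar> \<le> B * \<bar>h w\<bar>"
      using kernel_bounded[OF True] by (simp add: abs_mult sets_borel_on_imp_space[OF M] mult_right_mono)
  qed (use h in simp)
  also have "\<dots> = B * (LINT w|M. \<bar>h w\<bar>)" by simp
  finally show ?thesis using True by (simp add: A_density_def fun_on_def)
next
  \<comment> \<open>Off \<open>X\<close> the represented function is 0 by convention, so
    nonnegativity of \<open>B\<close> suffices.\<close>
  case False
  then show ?thesis using bound_nonneg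
    by (simp add: A_density_def fun_on_def integral_nonneg_AE)
qed

lemma signed_measure_cases:
  assumes "signed_measure \<Omega> \<mu>"
  obtains M h where "sets M = sets (borel_on \<Omega>)" "integrable M h" "\<mu> = density_signed M h"
  using signed_measures_common_density[OF assms assms] by metis

lemma normed_fun_space_integral_RKBS: "normed_fun_space (integral_RKBS X \<Omega> \<phi>)"
  unfolding integral_RKBS_def
proof (rule normed_fun_space_quotient)
  show "radon_measures \<Omega> \<noteq> {}"
    using radon_measures_eq[OF borel_domain] by (auto simp: signed_measure_def)
next
  fix \<mu> \<nu> assume "\<mu> \<in> radon_measures \<Omega>" "\<nu> \<in> radon_measures \<Omega>"
  then have "signed_measure \<Omega> \<mu>" "signed_measure \<Omega> \<nu>"
    by (auto simp: radon_measures_def)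
  then obtain M h k where M: "sets M = sets (borel_on \<Omega>)" and hk: "integrable M h" "integrable M k"
    and \<mu>: "\<mu> = density_signed M h" and \<nu>: "\<nu> = density_signed M k"
    by (rule signed_measures_common_density)
  let ?\<rho> = "density_signed M (\<lambda>w. h w + k w)"
  have i: "integrable M (\<lambda>w. h w + k w)" using hk by auto
  have "A_density X \<phi> M (\<lambda>w. h w + k w) = (\<lambda>x. A_density X \<phi> M h x + A_density X \<phi> M k x)"
    using integrable_kernel[OF M hk(1)] integrable_kernel[OF M hk(2)]
    by (auto simp: A_density_def fun_on_def fun_eq_iff distrib_left)
  moreover have "(LINT w|M. \<bar>h w + k w\<bar>) \<le> (LINT w|M. \<bar>h w\<bar> + \<bar>k w\<bar>)"
    using hk by (intro integral_mono) auto
  moreover have "(LINT w|M. \<bar>h w\<bar> + \<bar>k w\<bar>) = (LINT w|M. \<bar>h w\<bar>) + (LINT w|M. \<bar>k w\<bar>)"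
    using hk by (intro Bochner_Integration.integral_add) auto
  ultimately show "\<exists>\<rho>\<in>radon_measures \<Omega>.
      A_measure X \<Omega> \<phi> \<rho> = (\<lambda>x. A_measure X \<Omega> \<phi> \<mu> x + A_measure X \<Omega> \<phi> \<nu> x) \<and>
      tv_norm \<Omega> \<rho> \<le> tv_norm \<Omega> \<mu> + tv_norm \<Omega> \<nu>"
    using signed_measure_density_signed[OF M i] unfolding \<mu> \<nu>
    by (intro bexI[of _ ?\<rho>])
      (auto simp: A_measure_density_signed[OF M] tv_norm_density_signed[OF M] i hk
        radon_measures_eq[OF borel_domain])
next
  fix c \<mu> assume "\<mu> \<in> radon_measures \<Omega>"
  then have "signed_measure \<Omega> \<mu>" by (auto simp: radon_measures_def)
  then obtain M h where M: "sets M = sets (borel_on \<Omega>)" and h: "integrable M h"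
    and \<mu>: "\<mu> = density_signed M h"
    by (rule signed_measure_cases)
  have i: "integrable M (\<lambda>w. c * h w)" using h by auto
  have "A_density X \<phi> M (\<lambda>w. c * h w) = (\<lambda>x. c * A_density X \<phi> M h x)"
    by (auto simp: A_density_def fun_on_def fun_eq_iff mult.left_commute[of _ c])
  then show "\<exists>\<rho>\<in>radon_measures \<Omega>. A_measure X \<Omega> \<phi> \<rho> = (\<lambda>x. c * A_measure X \<Omega> \<phi> \<mu> x) \<and>
      tv_norm \<Omega> \<rho> \<le> \<bar>c\<bar> * tv_norm \<Omega> \<mu>"
    using signed_measure_density_signed[OF M i] unfolding \<mu>
    by (intro bexI[of _ "density_signed M (\<lambda>w. c * h w)"])
      (auto simp: A_measure_density_signed[OF M] tv_norm_density_signed[OF M] i h abs_mult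
        radon_measures_eq[OF borel_domain])
next
  fix \<mu> x assume "\<mu> \<in> radon_measures \<Omega>"
  then have "signed_measure \<Omega> \<mu>" by (auto simp: radon_measures_def)
  then obtain M h where M: "sets M = sets (borel_on \<Omega>)" and h: "integrable M h"
    and \<mu>: "\<mu> = density_signed M h"
    by (rule signed_measure_cases)
  show "\<bar>A_measure X \<Omega> \<phi> \<mu> x\<bar> \<le> B * tv_norm \<Omega> \<mu>"
    using abs_A_density_le[OF M h]
    by (simp add: \<mu> A_measure_density_signed[OF M h] tv_norm_density_signed[OF M h])
qed (simp add: tv_norm_def)

section \<open>Passing between signed measures and densities of probability measures\<close>

lemma ex_prob_measure: "\<exists>\<pi>. \<pi> \<in> prob_measures \<Omega>"
proof -
  obtain a where a: "a \<in> \<Omega>" using domain_ne by auto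
  \<comment> \<open>A Dirac measure. It later accompanies the zero measure, which cannot be
    normalised to a probability measure.\<close>
  define \<pi> where "\<pi> = return (borel_on \<Omega>) a"
  have P: "prob_space \<pi>"
    unfolding \<pi>_def by (rule prob_space_return) (simp only: space_borel_on a)
  have s: "sets \<pi> = sets (borel_on \<Omega>)" by (simp only: \<pi>_def sets_return)
  have "regular_on \<Omega> \<pi>"
    by (rule regular_on_finite_measure[OF borel_domain prob_space.finite_measure[OF P] s])
  with P s show ?thesis by (auto simp only: prob_measures_def)
qed

text \<open>The total variation of \<open>density_signed \<pi> h\<close> is the norm of
  \<open>h\<close> for exponent 1, which on a probability space is at most
  \<open>Lp_norm p \<pi> h\<close>; hence only an inequality.\<close>

lemma A_density_eq_A_measure:
  assumes \<pi>: "\<pi> \<in> prob_measures \<Omega>" and p: "1 \<le> p" and h: "h \<in> Lp_functions p \<pi>"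
  obtains \<mu> where "\<mu> \<in> radon_measures \<Omega>" "A_density X \<phi> \<pi> h = A_measure X \<Omega> \<phi> \<mu>"
    "tv_norm \<Omega> \<mu> \<le> Lp_norm p \<pi> h"
proof -
  have P: "prob_space \<pi>" and s: "sets \<pi> = sets (borel_on \<Omega>)"
    using \<pi> by (auto simp: prob_measures_def)
  have i: "integrable \<pi> h"
    using P p h by (intro Lp_functions_integrable) (auto simp: prob_space.finite_measure)
  show ?thesis
    using signed_measure_density_signed[OF s i] L1_le_Lp_norm[OF P p h]
    by (intro that[of "density_signed \<pi> h"])
      (auto simp: radon_measures_eq[OF borel_domain] A_measure_density_signed[OF s i]
        tv_norm_density_signed[OF s i])
qed

text \<open>Here the norms agree exactly, since a density of constant absolute value has the same
  norm for every exponent on a probability space.\<close>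

lemma A_measure_eq_A_density:
  assumes \<mu>: "\<mu> \<in> radon_measures \<Omega>" and p: "1 \<le> p"
  obtains \<pi> h where "\<pi> \<in> prob_measures \<Omega>" "h \<in> Lp_functions p \<pi>"
    "A_measure X \<Omega> \<phi> \<mu> = A_density X \<phi> \<pi> h" "Lp_norm p \<pi> h = tv_norm \<Omega> \<mu>"
proof -
  have "signed_measure \<Omega> \<mu>" using \<mu> by (auto simp: radon_measures_def)
  then obtain M s where M: "finite_measure M" "sets M = sets (borel_on \<Omega>)"
    and s[measurable]: "s \<in> borel_measurable M" and s1: "\<And>w. \<bar>s w\<bar> = 1"
    and \<mu>_eq: "\<mu> = density_signed M s"
    by (rule signed_measure_polar) blast
  interpret M: finite_measure M by fact
  have si: "integrable M s" using s1 by (auto intro!: M.integrable_const_bound[where B = 1])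
  define c where "c = measure M \<Omega>"
  have tv: "tv_norm \<Omega> \<mu> = c"
    using M by (simp add: \<mu>_eq tv_norm_density_signed[OF M(2) si] s1 c_def sets_borel_on_imp_space)
  show ?thesis
  proof (cases "c = 0")
    \<comment> \<open>With total mass 0 the represented function vanishes, so any probability
      measure with density 0 represents it.\<close>
    case True
    obtain \<pi> where \<pi>: "\<pi> \<in> prob_measures \<Omega>" using ex_prob_measure by blast
    have "\<bar>A_measure X \<Omega> \<phi> \<mu> x\<bar> \<le> B * 0" for x
      using abs_A_density_le[OF M(2) si] A_measure_density_signed[OF M(2) si]
      by (simp add: \<mu>_eq s1 True c_def[symmetric] sets_borel_on_imp_space[OF M(2)])
    then have "A_measure X \<Omega> \<phi> \<mu> = (\<lambda>x. 0)" by auto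
    then show ?thesis
      using \<pi> tv True
      by (intro that[of \<pi> "\<lambda>_. 0"])
        (auto simp: Lp_functions_def Lp_norm_def A_density_def fun_on_def)
  next
    case False
    then have c: "0 < c" by (simp add: c_def zero_less_measure_iff)
    \<comment> \<open>The factor \<open>1 / c\<close> normalises \<open>M\<close>; the factor
      \<open>c\<close> in \<open>h\<close> below compensates for it in the integral.\<close>
    define \<pi> where "\<pi> = density M (\<lambda>_. ennreal (1 / c))"
    have s\<pi>: "sets \<pi> = sets (borel_on \<Omega>)" by (simp add: \<pi>_def M(2))
    have P: "prob_space \<pi>"
    proof (rule prob_spaceI)
      have "emeasure \<pi> (space \<pi>) = ennreal (1 / c) * emeasure M \<Omega>"
        by (simp add: \<pi>_def emeasure_density_const sets_borel_on_imp_space[OF M(2), symmetric] sets.top)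
      also have "\<dots> = 1"
        using c by (simp add: M.emeasure_eq_measure c_def ennreal_mult[symmetric])
      finally show "emeasure \<pi> (space \<pi>) = 1" .
    qed
    have \<pi>: "\<pi> \<in> prob_measures \<Omega>"
      using P s\<pi> regular_on_finite_measure[OF borel_domain _ s\<pi>]
      by (auto simp: prob_measures_def prob_space.finite_measure)
    define h where "h w = c * s w" for w
    have h_abs: "\<bar>h w\<bar> = c" for w using c s1 by (simp add: h_def abs_mult)
    have hm: "h \<in> borel_measurable \<pi>" by (simp add: h_def[abs_def] \<pi>_def)
    have "h \<in> Lp_functions p \<pi>"
      using hm prob_space.finite_measure[OF P] by (simp add: Lp_functions_def h_abs finite_measure.integrable_const)
    moreover have "A_measure X \<Omega> \<phi> \<mu> = A_density X \<phi> \<pi> h"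
    proof -
      have "(LINT w|\<pi>. \<phi> (x, w) * h w) = (LINT w|M. \<phi> (x, w) * s w)" if "x \<in> X" for x
        using c kernel_measurable'[OF M(2) that] unfolding \<pi>_def h_def
        by (subst integral_density) auto
      then have "A_density X \<phi> \<pi> h = A_density X \<phi> M s"
        by (auto simp: A_density_def fun_on_def)
      then show ?thesis by (simp add: \<mu>_eq A_measure_density_signed[OF M(2) si])
    qed
    moreover have "Lp_norm p \<pi> h = tv_norm \<Omega> \<mu>"
      using c by (simp add: tv Lp_norm_const_abs[OF P p _ h_abs])
    ultimately show ?thesis using \<pi> by (intro that)
  qed
qed

section \<open>Equality of the elements and of the norms\<close>

lemma elems_union_p_norm_RKBS:
  assumes p: "1 \<le> p"
  shows "elems (union_space (prob_measures \<Omega>) (p_norm_RKBS X \<phi> p)) = elems (integral_RKBS X \<Omega> \<phi>)"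
proof (intro subset_antisym subsetI)
  fix f assume "f \<in> elems (union_space (prob_measures \<Omega>) (p_norm_RKBS X \<phi> p))"
  then obtain \<pi> h where "\<pi> \<in> prob_measures \<Omega>" "h \<in> Lp_functions p \<pi>" "f = A_density X \<phi> \<pi> h"
    by (auto simp: union_space_def p_norm_RKBS_def)
  then show "f \<in> elems (integral_RKBS X \<Omega> \<phi>)"
    using A_density_eq_A_measure[OF _ p] by (auto simp: integral_RKBS_def) (metis imageI)
next
  fix f assume "f \<in> elems (integral_RKBS X \<Omega> \<phi>)"
  then obtain \<mu> where "\<mu> \<in> radon_measures \<Omega>" "f = A_measure X \<Omega> \<phi> \<mu>"
    by (auto simp: integral_RKBS_def)
  then show "f \<in> elems (union_space (prob_measures \<Omega>) (p_norm_RKBS X \<phi> p))"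
    using A_measure_eq_A_density[OF _ p] by (simp add: union_space_def p_norm_RKBS_def) (metis imageI)
qed

text \<open>Both norms are infima over representations. Every \<open>\<mu>\<close> yields a density
  of equal norm, which gives \<le>; every density yields a \<open>\<mu>\<close> of no larger norm,
  which gives \<ge>.\<close>

lemma fnorm_union_p_norm_RKBS:
  assumes p: "1 \<le> p" and f: "f \<in> elems (integral_RKBS X \<Omega> \<phi>)"
  shows "fnorm (union_space (prob_measures \<Omega>) (p_norm_RKBS X \<phi> p)) f
       = fnorm (integral_RKBS X \<Omega> \<phi>) f"
proof -
  let ?I = "{\<pi> \<in> prob_measures \<Omega>. f \<in> elems (p_norm_RKBS X \<phi> p \<pi>)}"
  let ?H = "\<lambda>\<pi>. {h \<in> Lp_functions p \<pi>. f = A_density X \<phi> \<pi> h}"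
  let ?R = "{\<mu> \<in> radon_measures \<Omega>. f = A_measure X \<Omega> \<phi> \<mu>}"
  let ?n = "\<lambda>\<pi>. fnorm (p_norm_RKBS X \<phi> p \<pi>) f"
  have n_eq: "?n \<pi> = (INF h\<in>?H \<pi>. Lp_norm p \<pi> h)" for \<pi> by (simp add: p_norm_RKBS_def)
  \<comment> \<open>Real infima behave as expected only over nonempty sets bounded below, so
    nonemptiness and nonnegativity are collected first.\<close>
  have H_ne: "?H \<pi> \<noteq> {}" if "\<pi> \<in> ?I" for \<pi> using that by (auto simp: p_norm_RKBS_def)
  have Lp_nonneg: "0 \<le> Lp_norm p \<pi> h" for \<pi> :: "'b measure" and h by (simp add: Lp_norm_def)
  have n_nonneg: "0 \<le> ?n \<pi>" if "\<pi> \<in> ?I" for \<pi>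
    unfolding n_eq by (intro cINF_greatest H_ne[OF that] Lp_nonneg)
  have R_ne: "?R \<noteq> {}" using f by (auto simp: integral_RKBS_def)
  have tv_nonneg: "0 \<le> tv_norm \<Omega> \<mu>" for \<mu> by (simp add: tv_norm_def)
  have "f \<in> elems (union_space (prob_measures \<Omega>) (p_norm_RKBS X \<phi> p))"
    using f elems_union_p_norm_RKBS[OF p] by simp
  then have I_ne: "?I \<noteq> {}" by (auto simp: union_space_def)
  have "(INF \<pi>\<in>?I. ?n \<pi>) = (INF \<mu>\<in>?R. tv_norm \<Omega> \<mu>)"
  proof (rule antisym)
    show "(INF \<pi>\<in>?I. ?n \<pi>) \<le> (INF \<mu>\<in>?R. tv_norm \<Omega> \<mu>)"
    proof (rule cINF_greatest[OF R_ne])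
      fix \<mu> assume \<mu>: "\<mu> \<in> ?R"
      then obtain \<pi> h where \<pi>: "\<pi> \<in> prob_measures \<Omega>" and h: "h \<in> ?H \<pi>"
        and n: "Lp_norm p \<pi> h = tv_norm \<Omega> \<mu>"
        using A_measure_eq_A_density[OF _ p, of \<mu>] by auto metis
      have \<pi>I: "\<pi> \<in> ?I" using \<pi> h by (auto simp: p_norm_RKBS_def)
      have "(INF \<pi>\<in>?I. ?n \<pi>) \<le> ?n \<pi>"
        using n_nonneg by (intro cINF_lower \<pi>I bdd_belowI[of _ 0]) auto
      also have "\<dots> \<le> Lp_norm p \<pi> h"
        unfolding n_eq using Lp_nonneg by (intro cINF_lower h bdd_belowI[of _ 0]) auto
      finally show "(INF \<pi>\<in>?I. ?n \<pi>) \<le> tv_norm \<Omega> \<mu>" by (simp add: n)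
    qed
    show "(INF \<mu>\<in>?R. tv_norm \<Omega> \<mu>) \<le> (INF \<pi>\<in>?I. ?n \<pi>)"
    proof (rule cINF_greatest[OF I_ne])
      fix \<pi> assume \<pi>: "\<pi> \<in> ?I"
      show "(INF \<mu>\<in>?R. tv_norm \<Omega> \<mu>) \<le> ?n \<pi>"
        unfolding n_eq
      proof (rule cINF_greatest[OF H_ne[OF \<pi>]])
        fix h assume h: "h \<in> ?H \<pi>"
        obtain \<mu> where \<mu>: "\<mu> \<in> radon_measures \<Omega>" "A_density X \<phi> \<pi> h = A_measure X \<Omega> \<phi> \<mu>"
          "tv_norm \<Omega> \<mu> \<le> Lp_norm p \<pi> h"
          using A_density_eq_A_measure[OF _ p, of \<pi> h] \<pi> h by auto
        have "(INF \<mu>\<in>?R. tv_norm \<Omega> \<mu>) \<le> tv_norm \<Omega> \<mu>"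
          using \<mu> h tv_nonneg by (intro quotient_norm_le) auto
        with \<mu>(3) show "(INF \<mu>\<in>?R. tv_norm \<Omega> \<mu>) \<le> Lp_norm p \<pi> h" by simp
      qed
    qed
  qed
  then show ?thesis by (simp add: union_space_def integral_RKBS_def)
qed

theorem integral_RKBS_isometric_union:
  assumes "1 \<le> p"
  shows "integral_RKBS X \<Omega> \<phi> \<cong>\<^sub>i union_space (prob_measures \<Omega>) (p_norm_RKBS X \<phi> p)"
  by (intro isometrically_isomorphic_identity normed_fun_space_integral_RKBS
      elems_union_p_norm_RKBS fnorm_union_p_norm_RKBS assms)

end

text \<open>For empty \<open>\<Omega>\<close> there is no probability measure, so the union would
  have no elements while the integral space contains 0.\<close>

theorem corollary13:
  fixes X :: "(real ^ 'd) set" and \<Omega> :: "(real ^ 'e) set"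
    and \<phi> :: "(real ^ 'd) \<times> (real ^ 'e) \<Rightarrow> real" and p :: real
  assumes "closed X" and "closed \<Omega>" and "\<Omega> \<noteq> {}"
    and "\<phi> \<in> C0 (X \<times> \<Omega>)"
    and "1 \<le> p"
  shows "integral_RKBS X \<Omega> \<phi> \<cong>\<^sub>i union_space (prob_measures \<Omega>) (p_norm_RKBS X \<phi> p)"
proof -
  obtain B where B: "0 \<le> B" "\<And>z. z \<in> X \<times> \<Omega> \<Longrightarrow> \<bar>\<phi> z\<bar> \<le> B"
    using C0_bounded[OF assms(4)] by metis
  have cont: "continuous_on (X \<times> \<Omega>) \<phi>" using assms(4) by (simp add: C0_def)
  \<comment> \<open>Sections of the jointly continuous kernel are continuous, hence Borel on
    \<open>\<Omega>\<close>.\<close>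
  have "continuous_on \<Omega> (\<lambda>w. \<phi> (x, w))" if "x \<in> X" for x
    by (rule continuous_on_compose2[OF cont])
      (use that in \<open>auto intro!: continuous_intros\<close>)
  then interpret bounded_kernel X \<Omega> \<phi> B
    using assms(2,3) B
    by unfold_locales (auto intro: borel_measurable_continuous_on_restrict)
  show ?thesis by (rule integral_RKBS_isometric_union[OF assms(5)])
qed

end
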